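(* Let $d\in\mathbb N$, let $F\in\mathcal C_d^{\mathsf R}$ and let $\theta\in\mathbb R$ be deterministic with $F+\theta\in\mathbb N_0$ almost surely. Assume that, for some $\varepsilon\in(0,\frac12]$, $$\varepsilon\le p_k\le1-\varepsilon\quad\text{for every }k\text{ with }\mathrm{Inf}_k(F)>0.\qquad(\ast)$$ Then every coordinate $k$ with $\mathrm{Inf}_k(F)>0$ satisfies $$d\,d!\,\mathrm{Inf}_k(F)\ge\varepsilon^d(1-\varepsilon),$$ and $F$ depends on at most $\dfrac{d\,m_2(F)}{\varepsilon^d(1-\varepsilon)}$ coordinates. In the symmetric case ($p_k=\frac12$ for all $k$), $\mathrm{Inf}_k(F)\ge\dfrac{2^{-(d+1)}}{d\,d!}$ for every coordinate $k$ with $\mathrm{Inf}_k(F)>0$. Consequently, no sequence of integer-valued shifts $F_n+\theta_n$ (with $F_n\in\mathcal C_d^{\mathsf R}$ and $\theta_n\in\mathbb R$ deterministic) satisfying $(\ast)$ (with $F_n$ in place of $F$), with fixed $d$, a common $\varepsilon>0$, and uniformly bounded variances, can converge in law to a nondegenerate Poisson law.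
   Context: $\mathbb N=\{1,2,\dots\}$, $\mathbb N_0=\mathbb N\cup\{0\}$, $m_2(F)=\mathbb E[F^2]$. $(X_k)_{k\ge1}$ are independent with $\mathbb P(X_k=1)=p_k\in(0,1)$, $\mathbb P(X_k=-1)=q_k=1-p_k$, and $Y_k=(X_k-p_k+q_k)/(2\sqrt{p_kq_k})$. For $d\ge1$, the $d$-th Rademacher chaos $\mathcal C_d^{\mathsf R}$ is the set of all $Q_d(f;Y)=\sum_{i_1,\dots,i_d\in\mathbb N}f(i_1,\dots,i_d)Y_{i_1}\cdots Y_{i_d}$, where $f:\mathbb N^d\to\mathbb R$ is symmetric, square-summable and vanishes whenever two of its arguments coincide. For $F=Q_d(f;Y)$ put $\mathrm{Inf}_k(F)=\sum_{i_1,\dots,i_{d-1}}f(i_1,\dots,i_{d-1},k)^2$ (equal to $f(k)^2$ if $d=1$). $F$ depends on the coordinate $k$ if $\mathrm{Inf}_k(F)>0$. A nondegenerate Poisson law is a Poisson law with mean $\lambda>0$. *)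

theory Defs
  imports "HOL-Probability.Probability"
begin

text \<open>The coordinates are indexed by all of \<^typ>\<open>nat\<close>, i.e. the positive integers shifted by one.\<close>

locale rademacher_sequence = prob_space M for M :: "'a measure" +
  fixes X :: "nat \<Rightarrow> 'a \<Rightarrow> real" and p :: "nat \<Rightarrow> real"
  assumes indep: "indep_vars (\<lambda>_. borel) X UNIV"
    and p_pos: "\<And>k. 0 < p k"
    and p_less_1: "\<And>k. p k < 1"
    and prob_plus: "\<And>k. \<P>(x in M. X k x = 1) = p k"
    and prob_minus: "\<And>k. \<P>(x in M. X k x = - 1) = 1 - p k"

definition normalized ::
    "(nat \<Rightarrow> real) \<Rightarrow> (nat \<Rightarrow> 'a \<Rightarrow> real) \<Rightarrow> nat \<Rightarrow> 'a \<Rightarrow> real" where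
  "normalized p X k x = (X k x - p k + (1 - p k)) / (2 * sqrt (p k * (1 - p k)))"

definition tuples :: "nat \<Rightarrow> nat list set" where
  "tuples d = {is. length is = d}"

text \<open>Only the values of the kernel on lists of length \<open>d\<close> matter.\<close>

definition chaos_kernel :: "nat \<Rightarrow> (nat list \<Rightarrow> real) \<Rightarrow> bool" where
  "chaos_kernel d f \<longleftrightarrow>
     (\<forall>is\<in>tuples d. \<forall>js\<in>tuples d. mset is = mset js \<longrightarrow> f is = f js) \<and>
     (\<lambda>is. (f is)\<^sup>2) summable_on tuples d \<and>
     (\<forall>is\<in>tuples d. \<not> distinct is \<longrightarrow> f is = 0)"

definition chaos_partial_sum ::
    "(nat list \<Rightarrow> real) \<Rightarrow> (nat \<Rightarrow> 'a \<Rightarrow> real) \<Rightarrow> nat list set \<Rightarrow> 'a \<Rightarrow> real" where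
  "chaos_partial_sum f Y A x = (\<Sum>is\<in>A. f is * (\<Prod>i\<leftarrow>is. Y i x))"

text \<open>\<open>is_chaos_sum M d f Y F\<close>: \<open>F\<close> is (a version of) the multiple sum
  \<open>Q\<^sub>d(f;Y)\<close>, understood as the limit in \<open>L\<^sup>2(M)\<close> of the net of finite partial sums.\<close>

definition is_chaos_sum ::
    "'a measure \<Rightarrow> nat \<Rightarrow> (nat list \<Rightarrow> real) \<Rightarrow> (nat \<Rightarrow> 'a \<Rightarrow> real) \<Rightarrow> ('a \<Rightarrow> real) \<Rightarrow> bool" where
  "is_chaos_sum M d f Y F \<longleftrightarrow>
     F \<in> borel_measurable M \<and> integrable M (\<lambda>x. (F x)\<^sup>2) \<and>
     ((\<lambda>A. \<integral>x. (F x - chaos_partial_sum f Y A x)\<^sup>2 \<partial>M) \<longlongrightarrow> 0)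
       (finite_subsets_at_top (tuples d))"

text \<open>\<open>F\<close> lies in the \<open>d\<close>-th Rademacher chaos, with kernel \<open>f\<close>; the chaos itself is the set of
  all \<open>F\<close> for which some \<open>f\<close> satisfies this.\<close>

definition in_rademacher_chaos ::
    "'a measure \<Rightarrow> (nat \<Rightarrow> 'a \<Rightarrow> real) \<Rightarrow> (nat \<Rightarrow> real) \<Rightarrow> nat \<Rightarrow> (nat list \<Rightarrow> real) \<Rightarrow>
      ('a \<Rightarrow> real) \<Rightarrow> bool" where
  "in_rademacher_chaos M X p d f F \<longleftrightarrow>
     chaos_kernel d f \<and> is_chaos_sum M d f (normalized p X) F"

definition influence :: "nat \<Rightarrow> (nat list \<Rightarrow> real) \<Rightarrow> nat \<Rightarrow> real" where
  "influence d f k = (\<Sum>\<^sub>\<infinity>is\<in>tuples (d - 1). (f (is @ [k]))\<^sup>2)"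

definition poisson_law :: "real \<Rightarrow> real measure" where
  "poisson_law l = distr (measure_pmf (poisson_pmf l)) borel real"

end

theory Submission imports Defs begin

text \<open>
Write \<open>F = \<Sum>\<^sub>T c\<^sub>T \<Prod>\<^sub>i\<^sub>\<in>\<^sub>T Y\<^sub>i\<close>, the sum running over sets \<open>T\<close> of \<open>d\<close> coordinates, where \<open>c\<^sub>T\<close> is \<open>d!\<close>
times the value of the kernel on \<open>T\<close>. Flipping the sign of coordinate \<open>i\<close> changes \<open>Y\<^sub>i\<close> by
\<open>1 / \<sigma>\<^sub>i\<close> with \<open>\<sigma>\<^sub>i = sqrt (p\<^sub>i (1 - p\<^sub>i))\<close>. The whole argument rests on the fact that differences of
integers are integers.

Taking differences in all \<open>d\<close> coordinates of one set \<open>T\<close> leaves \<open>c\<^sub>T / \<Prod>\<^sub>i\<^sub>\<in>\<^sub>T \<sigma>\<^sub>i\<close>, which is therefore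
an integer (\<open>scaled_walsh_coeff_integer\<close>). The differences are taken for the finite partial sums,
where the mean square distance to the integers is controlled, and the limit is taken afterwards.
So the nonzero \<open>c\<^sub>T\<close> are bounded away from \<open>0\<close>, and as they are square-summable, there are only
finitely many of them: \<open>F\<close> is a polynomial in finitely many signs (\<open>F_eq_walsh\<close>).

Taking a single difference in coordinate \<open>k\<close> leaves \<open>B / \<sigma>\<^sub>k\<close>, where \<open>B\<close> is a polynomial of
degree \<open>d - 1\<close> whose second moment is \<open>d d!\<close> times the influence of \<open>k\<close>. Where the integer
\<open>B / \<sigma>\<^sub>k\<close> does not vanish, its square is at least \<open>1\<close>, and a nonzero polynomial of degree
\<open>d - 1\<close> is nonzero with probability at least \<open>\<epsilon>\<^sup>d\<^sup>-\<^sup>1\<close> (\<open>nonvanishing_weight\<close>). Hence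
\<open>d d! Inf\<^sub>k(F) \<ge> \<sigma>\<^sub>k\<^sup>2 \<epsilon>\<^sup>d\<^sup>-\<^sup>1 \<ge> \<epsilon>\<^sup>d (1 - \<epsilon>)\<close> (\<open>influence_ge\<close>).

Adding these bounds over the dependent coordinates gives their number, because the left-hand
sides add up to \<open>d\<close> times the second moment of \<open>F\<close> (\<open>total_influence\<close>). Bounded variances thus
bound the number of coordinates, and with it the number of values of \<open>F\<close>, whereas a sequence
converging to a Poisson law has unboundedly many values (\<open>poisson_limit_has_many_values\<close>).
\<close>

section \<open>Multilinear polynomials on the biased cube\<close>

text \<open>A point of the cube \<open>{-1, 1}\<^sup>V\<close> is encoded by the set \<open>U \<subseteq> V\<close> of the coordinates that equal \<open>1\<close>;
\<open>config_weight p V U\<close> is then its probability. The main facts about \<open>cube_mean\<close> are proved by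
adding one coordinate \<open>v\<close> at a time: a multilinear polynomial is \<open>A + y\<^sub>v B\<close> with \<open>A\<close>, \<open>B\<close> free
of \<open>v\<close>, and the mean over the cube is a two-point average of means over the smaller cube.\<close>

definition config_weight :: "(nat \<Rightarrow> real) \<Rightarrow> nat set \<Rightarrow> nat set \<Rightarrow> real" where
  "config_weight p V U = (\<Prod>i\<in>V. if i \<in> U then p i else 1 - p i)"

definition cube_mean :: "(nat \<Rightarrow> real) \<Rightarrow> nat set \<Rightarrow> (nat set \<Rightarrow> real) \<Rightarrow> real" where
  "cube_mean p V g = (\<Sum>U\<in>Pow V. config_weight p V U * g U)"

definition coin :: "(nat \<Rightarrow> real) \<Rightarrow> nat \<Rightarrow> bool \<Rightarrow> real" where
  "coin p i b = (of_bool b - p i) / sqrt (p i * (1 - p i))"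

text \<open>The Walsh (Fourier) expansion on the biased cube, whose basis functions are orthonormal for
\<open>cube_mean\<close>. It is evaluated at an arbitrary set \<open>U\<close>, of which only \<open>U \<inter> V\<close> matters, so
that the same point can be fed to polynomials in different sets of variables.\<close>

definition walsh :: "(nat \<Rightarrow> real) \<Rightarrow> (nat set \<Rightarrow> real) \<Rightarrow> nat set \<Rightarrow> nat set \<Rightarrow> real" where
  "walsh p b V U = (\<Sum>T\<in>Pow V. b T * (\<Prod>i\<in>T. coin p i (i \<in> U)))"

lemma sum_Pow_insert:
  fixes g :: "nat set \<Rightarrow> real"
  assumes "finite V" "v \<notin> V"
  shows "(\<Sum>T\<in>Pow (insert v V). g T) = (\<Sum>T\<in>Pow V. g T + g (insert v T))"
proof -
  have inj: "inj_on (insert v) (Pow V)"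
    using assms(2) by (auto simp: inj_on_def)
  have "(\<Sum>T\<in>Pow (insert v V). g T) = (\<Sum>T\<in>Pow V. g T) + (\<Sum>T\<in>insert v ` Pow V. g T)"
    unfolding Pow_insert using assms by (intro sum.union_disjoint) auto
  also have "(\<Sum>T\<in>insert v ` Pow V. g T) = (\<Sum>T\<in>Pow V. g (insert v T))"
    by (simp add: sum.reindex[OF inj])
  finally show ?thesis by (simp add: sum.distrib)
qed

lemma config_weight_insert:
  assumes "finite V" "v \<notin> V" "U \<subseteq> V"
  shows "config_weight p (insert v V) U = (1 - p v) * config_weight p V U"
    and "config_weight p (insert v V) (insert v U) = p v * config_weight p V U"
proof -
  have "v \<notin> U" using assms by auto
  then show "config_weight p (insert v V) U = (1 - p v) * config_weight p V U"
    using assms by (simp add: config_weight_def)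
  have "(\<Prod>i\<in>V. if i = v \<or> i \<in> U then p i else 1 - p i) = (\<Prod>i\<in>V. if i \<in> U then p i else 1 - p i)"
    using assms(2) by (intro prod.cong) auto
  then show "config_weight p (insert v V) (insert v U) = p v * config_weight p V U"
    using assms by (simp add: config_weight_def)
qed

lemma config_weight_pos:
  assumes "\<And>i. i \<in> V \<Longrightarrow> 0 < p i \<and> p i < 1"
  shows "config_weight p V U > 0"
  unfolding config_weight_def using assms by (intro prod_pos) auto

lemma config_weight_nonneg:
  assumes "\<And>i. i \<in> V \<Longrightarrow> 0 < p i \<and> p i < 1"
  shows "config_weight p V U \<ge> 0"
  unfolding config_weight_def using assms by (intro prod_nonneg) (auto simp: less_imp_le)

lemma cube_mean_mono:
  assumes "\<And>i. i \<in> V \<Longrightarrow> 0 < p i \<and> p i < 1" "\<And>U. U \<subseteq> V \<Longrightarrow> g U \<le> h U"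
  shows "cube_mean p V g \<le> cube_mean p V h"
  unfolding cube_mean_def using assms
  by (intro sum_mono mult_left_mono config_weight_nonneg) auto

lemma cube_mean_cong:
  assumes "\<And>U. U \<subseteq> V \<Longrightarrow> g U = h U"
  shows "cube_mean p V g = cube_mean p V h"
  unfolding cube_mean_def using assms by (intro sum.cong) auto

lemma cube_mean_scale: "cube_mean p V (\<lambda>U. c * g U) = c * cube_mean p V g"
  by (simp add: cube_mean_def sum_distrib_left mult_ac)

lemma cube_mean_add: "cube_mean p V (\<lambda>U. g U + h U) = cube_mean p V g + cube_mean p V h"
  by (simp add: cube_mean_def sum.distrib algebra_simps)

lemma cube_mean_insert:
  assumes "finite V" "v \<notin> V"
  shows "cube_mean p (insert v V) g =
    cube_mean p V (\<lambda>U. p v * g (insert v U) + (1 - p v) * g U)"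
  unfolding cube_mean_def sum_Pow_insert[OF assms]
  by (intro sum.cong refl) (simp add: config_weight_insert assms algebra_simps)

lemma cube_mean_const:
  assumes "finite V" shows "cube_mean p V (\<lambda>U. c) = c"
  using assms
proof (induction V rule: finite_induct)
  case empty
  then show ?case by (simp add: cube_mean_def config_weight_def)
next
  case (insert v V)
  have "p v * c + (1 - p v) * c = c" by (simp add: algebra_simps)
  then show ?case using insert by (simp add: cube_mean_insert)
qed

lemma walsh_scale: "walsh p (\<lambda>T. c * b T) V U = c * walsh p b V U"
  by (simp add: walsh_def sum_distrib_left mult_ac)

lemma walsh_support:
  assumes "finite V'" "V \<subseteq> V'" "\<And>T. b T \<noteq> 0 \<Longrightarrow> T \<subseteq> V" "U \<inter> V = U' \<inter> V"
  shows "walsh p b V' U = walsh p b V U'"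
proof -
  have "walsh p b V' U = (\<Sum>T\<in>Pow V. b T * (\<Prod>i\<in>T. coin p i (i \<in> U)))"
    unfolding walsh_def using assms(1-3) by (intro sum.mono_neutral_right) auto
  also have "\<dots> = walsh p b V U'"
    unfolding walsh_def
  proof (rule sum.cong[OF refl])
    fix T assume "T \<in> Pow V"
    then have "i \<in> U \<longleftrightarrow> i \<in> U'" if "i \<in> T" for i using that assms(4) by auto
    then have "(\<Prod>i\<in>T. coin p i (i \<in> U)) = (\<Prod>i\<in>T. coin p i (i \<in> U'))"
      by (intro prod.cong) auto
    then show "b T * (\<Prod>i\<in>T. coin p i (i \<in> U)) = b T * (\<Prod>i\<in>T. coin p i (i \<in> U'))" by simp
  qed
  finally show ?thesis .
qed

lemma walsh_insert_coord:
  assumes "v \<notin> V"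
  shows "walsh p b V (insert v U) = walsh p b V U"
proof -
  have "(\<Prod>i\<in>T. coin p i (i \<in> insert v U)) = (\<Prod>i\<in>T. coin p i (i \<in> U))" if "T \<subseteq> V" for T
  proof (rule prod.cong[OF refl])
    fix i assume "i \<in> T"
    then have "i \<noteq> v" using that assms by auto
    then show "coin p i (i \<in> insert v U) = coin p i (i \<in> U)" by simp
  qed
  then show ?thesis by (simp add: walsh_def)
qed

lemma walsh_insert:
  assumes "finite V" "v \<notin> V"
  shows "walsh p b (insert v V) U =
    walsh p b V U + coin p v (v \<in> U) * walsh p (\<lambda>T. b (insert v T)) V U"
proof -
  have *: "(\<Prod>i\<in>insert v T. coin p i (i \<in> U)) = coin p v (v \<in> U) * (\<Prod>i\<in>T. coin p i (i \<in> U))"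
    if "T \<in> Pow V" for T
  proof -
    have "finite T" "v \<notin> T" using that assms finite_subset by auto
    then show ?thesis by simp
  qed
  show ?thesis
    unfolding walsh_def sum_Pow_insert[OF assms] sum_distrib_left sum.distrib
    by (simp add: * mult_ac)
qed

lemma cube_mean_walsh_insert:
  assumes "finite V" "v \<notin> V"
  shows "cube_mean p (insert v V) (\<lambda>U. h (walsh p b (insert v V) U)) =
    cube_mean p V (\<lambda>U.
      p v * h (walsh p b V U + coin p v True * walsh p (\<lambda>T. b (insert v T)) V U) +
      (1 - p v) * h (walsh p b V U + coin p v False * walsh p (\<lambda>T. b (insert v T)) V U))"
  unfolding cube_mean_insert[OF assms]
proof (rule cube_mean_cong)
  fix U assume "U \<subseteq> V"
  then have "v \<notin> U" using assms by auto
  then show "p v * h (walsh p b (insert v V) (insert v U)) + (1 - p v) * h (walsh p b (insert v V) U) =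
      p v * h (walsh p b V U + coin p v True * walsh p (\<lambda>T. b (insert v T)) V U) +
      (1 - p v) * h (walsh p b V U + coin p v False * walsh p (\<lambda>T. b (insert v T)) V U)"
    by (simp add: walsh_insert assms walsh_insert_coord)
qed

lemma coin_centred: "p i * coin p i True + (1 - p i) * coin p i False = 0"
  by (simp add: coin_def divide_simps algebra_simps)

lemma coin_gap:
  "coin p i True - coin p i False = 1 / sqrt (p i * (1 - p i))"
  by (simp add: coin_def diff_divide_distrib)

lemma coin_unit_variance:
  assumes "0 < p i" "p i < 1"
  shows "p i * (coin p i True)\<^sup>2 + (1 - p i) * (coin p i False)\<^sup>2 = 1"
proof -
  have "p i * (1 - p i) > 0" using assms by simp
  then have "(sqrt (p i * (1 - p i)))\<^sup>2 = p i * (1 - p i)" by simp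
  then show ?thesis using assms
    by (simp add: coin_def power_divide divide_simps) (simp add: power2_eq_square algebra_simps)
qed

lemma cube_mean_walsh:
  assumes "finite V"
  shows "cube_mean p V (walsh p b V) = b {}"
  using assms
proof (induction V arbitrary: b rule: finite_induct)
  case empty
  then show ?case by (simp add: cube_mean_def config_weight_def walsh_def)
next
  case (insert v V)
  have "cube_mean p (insert v V) (walsh p b (insert v V)) = cube_mean p V (walsh p b V)"
    unfolding cube_mean_walsh_insert[OF insert.hyps, where h = "\<lambda>t. t"]
  proof (rule cube_mean_cong)
    fix U
    let ?A = "walsh p b V U" and ?B = "walsh p (\<lambda>T. b (insert v T)) V U"
    have "p v * (?A + coin p v True * ?B) + (1 - p v) * (?A + coin p v False * ?B) =
        ?A + (p v * coin p v True + (1 - p v) * coin p v False) * ?B"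
      by (simp add: algebra_simps)
    then show "p v * (?A + coin p v True * ?B) + (1 - p v) * (?A + coin p v False * ?B) = ?A"
      by (simp add: coin_centred)
  qed
  then show ?case using insert.IH by simp
qed

text \<open>Parseval's identity. The cross term in the two-point average of \<open>(A + y\<^sub>v B)\<^sup>2\<close> drops out because
\<open>y\<^sub>v\<close> is centred, and the coefficient of \<open>B\<^sup>2\<close> is the variance \<open>1\<close> of \<open>y\<^sub>v\<close>.\<close>

lemma cube_mean_walsh_square:
  assumes "finite V" "\<And>i. i \<in> V \<Longrightarrow> 0 < p i \<and> p i < 1"
  shows "cube_mean p V (\<lambda>U. (walsh p b V U)\<^sup>2) = (\<Sum>T\<in>Pow V. (b T)\<^sup>2)"
  using assms
proof (induction V arbitrary: b rule: finite_induct)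
  case empty
  then show ?case by (simp add: cube_mean_def config_weight_def walsh_def)
next
  case (insert v V)
  have "cube_mean p (insert v V) (\<lambda>U. (walsh p b (insert v V) U)\<^sup>2) =
      cube_mean p V (\<lambda>U. (walsh p b V U)\<^sup>2 + (walsh p (\<lambda>T. b (insert v T)) V U)\<^sup>2)"
    unfolding cube_mean_walsh_insert[OF insert.hyps(1,2), where h = "\<lambda>t. t\<^sup>2"]
  proof (rule cube_mean_cong)
    fix U
    let ?A = "walsh p b V U" and ?B = "walsh p (\<lambda>T. b (insert v T)) V U"
    let ?s = "coin p v True" and ?t = "coin p v False"
    have "p v * (?A + ?s * ?B)\<^sup>2 + (1 - p v) * (?A + ?t * ?B)\<^sup>2 =
        ?A\<^sup>2 + 2 * (p v * ?s + (1 - p v) * ?t) * ?A * ?B +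
        (p v * ?s\<^sup>2 + (1 - p v) * ?t\<^sup>2) * ?B\<^sup>2"
      by (simp add: power2_eq_square algebra_simps)
    then show "p v * (?A + ?s * ?B)\<^sup>2 + (1 - p v) * (?A + ?t * ?B)\<^sup>2 = ?A\<^sup>2 + ?B\<^sup>2"
      using insert.prems[of v] by (simp add: coin_centred coin_unit_variance)
  qed
  also have "\<dots> = (\<Sum>T\<in>Pow V. (b T)\<^sup>2) + (\<Sum>T\<in>Pow V. (b (insert v T))\<^sup>2)"
    using insert.IH insert.prems by (simp add: cube_mean_add)
  finally show ?case
    by (simp add: sum_Pow_insert insert.hyps sum.distrib)
qed

text \<open>A Schwartz-Zippel bound for the biased cube. If the coefficient polynomial \<open>B\<close> in \<open>A + y\<^sub>v B\<close> is
not zero, then at every point where \<open>B\<close> does not vanish at most one of the two values of \<open>y\<^sub>v\<close>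
makes the sum zero; this costs a factor \<open>\<epsilon>\<close>, and \<open>B\<close> has smaller degree. If \<open>B\<close> is zero, the
polynomial does not involve \<open>v\<close> and nothing is lost. So the exponent is the degree \<open>m\<close> and not
the number of variables.\<close>

lemma nonvanishing_weight:
  assumes "finite V" "0 < \<epsilon>" "\<epsilon> \<le> 1" "\<And>i. i \<in> V \<Longrightarrow> \<epsilon> \<le> p i \<and> p i \<le> 1 - \<epsilon>"
    and "T0 \<subseteq> V" "b T0 \<noteq> 0" "\<And>T. T \<subseteq> V \<Longrightarrow> b T \<noteq> 0 \<Longrightarrow> card T \<le> m"
  shows "cube_mean p V (\<lambda>U. of_bool (walsh p b V U \<noteq> 0)) \<ge> \<epsilon> ^ m"
  using assms
proof (induction V arbitrary: b m T0 rule: finite_induct)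
  case empty
  then have "walsh p b {} = (\<lambda>U. b {})" "b {} \<noteq> 0"
    by (auto simp: walsh_def)
  then show ?case using empty by (simp add: cube_mean_def config_weight_def power_le_one)
next
  case (insert v V)
  let ?b' = "\<lambda>T. b (insert v T)"
  have p01: "0 < p i \<and> p i < 1" if "i \<in> insert v V" for i
    using insert.prems(1) insert.prems(3)[OF that] by linarith
  have pv: "\<epsilon> \<le> p v" "p v \<le> 1 - \<epsilon>" using insert.prems(3)[of v] by auto
  have fin: "finite T" if "T \<subseteq> V" for T
    using that insert.hyps finite_subset by blast
  show ?case
  proof (cases "\<exists>T\<subseteq>V. ?b' T \<noteq> 0")
    case True
    then obtain T1 where T1: "T1 \<subseteq> V" "?b' T1 \<noteq> 0" by blast
    have cardv: "Suc (card T) \<le> m" if "T \<subseteq> V" "?b' T \<noteq> 0" for T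
    proof -
      have "v \<notin> T" "insert v T \<subseteq> insert v V" using that insert.hyps by auto
      then show ?thesis
        using insert.prems(6)[of "insert v T"] that fin[of T] by simp
    qed
    then obtain m' where m': "m = Suc m'" using T1 by (metis Suc_le_D)
    have "\<epsilon> ^ m' \<le> cube_mean p V (\<lambda>U. of_bool (walsh p ?b' V U \<noteq> 0))"
    proof (rule insert.IH[where b = ?b', OF insert.prems(1,2) _ T1])
      show "\<epsilon> \<le> p i \<and> p i \<le> 1 - \<epsilon>" if "i \<in> V" for i
        using insert.prems(3)[of i] that by simp
      show "card T \<le> m'" if "T \<subseteq> V" "?b' T \<noteq> 0" for T
        using cardv[OF that] m' by simp
    qed
    then have "\<epsilon> ^ m \<le> cube_mean p V (\<lambda>U. \<epsilon> * of_bool (walsh p ?b' V U \<noteq> 0))"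
      using insert.prems(1) by (simp add: m' cube_mean_scale)
    also have "\<dots> \<le> cube_mean p V (\<lambda>U.
      p v * of_bool (walsh p b V U + coin p v True * walsh p ?b' V U \<noteq> 0) +
      (1 - p v) * of_bool (walsh p b V U + coin p v False * walsh p ?b' V U \<noteq> 0))"
    proof (rule cube_mean_mono)
      fix U
      let ?A = "walsh p b V U" and ?B = "walsh p ?b' V U"
      have gap: "coin p v True \<noteq> coin p v False"
        using coin_gap[of p v] p01[of v] by auto
      have "?A + coin p v True * ?B \<noteq> 0 \<or> ?A + coin p v False * ?B \<noteq> 0" if "?B \<noteq> 0"
      proof (rule ccontr)
        assume "\<not> ?thesis"
        then have "coin p v True * ?B = coin p v False * ?B" by linarith
        then show False using gap that by simp
      qed
      then show "\<epsilon> * of_bool (?B \<noteq> 0) \<le> p v * of_bool (?A + coin p v True * ?B \<noteq> 0) +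
          (1 - p v) * of_bool (?A + coin p v False * ?B \<noteq> 0)"
        using pv insert.prems(1) by (cases "?B = 0") auto
    qed (use p01 in auto)
    also have "\<dots> = cube_mean p (insert v V) (\<lambda>U. of_bool (walsh p b (insert v V) U \<noteq> 0))"
      by (rule cube_mean_walsh_insert[OF insert.hyps(1,2), where h = "\<lambda>t. of_bool (t \<noteq> 0)", symmetric])
    finally show ?thesis .
  next
    case False
    have "v \<notin> T0"
    proof
      assume "v \<in> T0"
      then have "insert v (T0 - {v}) = T0" "T0 - {v} \<subseteq> V" using insert.prems(4) by auto
      then show False using False insert.prems(5) by metis
    qed
    then have T0: "T0 \<subseteq> V" using insert.prems(4)  by auto
    have "\<epsilon> ^ m \<le> cube_mean p V (\<lambda>U. of_bool (walsh p b V U \<noteq> 0))"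
    proof (rule insert.IH[where b = b, OF insert.prems(1,2) _ T0 insert.prems(5)])
      show "\<epsilon> \<le> p i \<and> p i \<le> 1 - \<epsilon>" if "i \<in> V" for i
        using insert.prems(3)[of i] that by simp
      show "card T \<le> m" if "T \<subseteq> V" "b T \<noteq> 0" for T
        using insert.prems(6)[of T] that by blast
    qed
    also have "\<dots> = cube_mean p (insert v V) (\<lambda>U. of_bool (walsh p b (insert v V) U \<noteq> 0))"
      unfolding cube_mean_walsh_insert[OF insert.hyps(1,2), where h = "\<lambda>t. of_bool (t \<noteq> 0)"]
    proof (rule cube_mean_cong)
      fix U
      have "walsh p ?b' V U = 0" using False by (simp add: walsh_def)
      then show "of_bool (walsh p b V U \<noteq> 0) =
        p v * of_bool (walsh p b V U + coin p v True * walsh p ?b' V U \<noteq> 0) +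
        (1 - p v) * of_bool (walsh p b V U + coin p v False * walsh p ?b' V U \<noteq> 0)"
        by simp
    qed
    finally show ?thesis .
  qed
qed

section \<open>Distance to the integers and iterated differences\<close>

text \<open>The distance to the nearest integer measures how far the approximants of an integer-valued
variable are from being integer-valued themselves.\<close>

definition int_dist :: "real \<Rightarrow> real" where
  "int_dist t = \<bar>t - of_int (round t)\<bar>"

lemma int_dist_le:
  assumes "n \<in> \<int>"
  shows "int_dist t \<le> \<bar>t - n\<bar>"
  using assms round_diff_minimal[of t] by (auto simp: int_dist_def elim!: Ints_cases)

lemma int_dist_nonneg: "int_dist t \<ge> 0" by (simp add: int_dist_def)

lemma int_dist_eq_0: "int_dist t = 0 \<Longrightarrow> t \<in> \<int>"
  by (simp add: int_dist_def) (metis Ints_of_int)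

lemma int_dist_diff_square: "(int_dist (s - t))\<^sup>2 \<le> 2 * ((int_dist s)\<^sup>2 + (int_dist t)\<^sup>2)"
proof -
  have "int_dist (s - t) \<le> \<bar>(s - t) - (of_int (round s) - of_int (round t))\<bar>"
    by (rule int_dist_le) auto
  also have "\<dots> \<le> int_dist s + int_dist t" unfolding int_dist_def by linarith
  finally have "(int_dist (s - t))\<^sup>2 \<le> (int_dist s + int_dist t)\<^sup>2"
    by (intro power_mono int_dist_nonneg)
  also have "\<dots> \<le> 2 * ((int_dist s)\<^sup>2 + (int_dist t)\<^sup>2)"
    using zero_le_power2[of "int_dist s - int_dist t"] by (simp add: power2_eq_square algebra_simps)
  finally show ?thesis .
qed

lemma int_dist_square_le_mix:
  assumes "0 < q" "q < 1"
  shows "q * (1 - q) * (int_dist (s - t))\<^sup>2 \<le> 2 * (q * (int_dist s)\<^sup>2 + (1 - q) * (int_dist t)\<^sup>2)"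
proof -
  have "q * (1 - q) * (int_dist (s - t))\<^sup>2 \<le> q * (1 - q) * (2 * ((int_dist s)\<^sup>2 + (int_dist t)\<^sup>2))"
    using assms by (intro mult_left_mono int_dist_diff_square) auto
  also have "\<dots> = 2 * (q * (1 - q) * (int_dist s)\<^sup>2 + (1 - q) * q * (int_dist t)\<^sup>2)"
    by (simp add: algebra_simps)
  also have "\<dots> \<le> 2 * (q * 1 * (int_dist s)\<^sup>2 + (1 - q) * 1 * (int_dist t)\<^sup>2)"
    using assms by (intro mult_left_mono add_mono mult_right_mono) auto
  finally show ?thesis by simp
qed

text \<open>The product over \<open>S\<close> of the jumps of the normalized variables: the factor by which the leading
coefficient is multiplied when differences are taken in all coordinates of \<open>S\<close>.\<close>

definition gap :: "(nat \<Rightarrow> real) \<Rightarrow> nat set \<Rightarrow> real" where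
  "gap p S = (\<Prod>i\<in>S. 1 / sqrt (p i * (1 - p i)))"

text \<open>Differencing in all coordinates of \<open>S\<close> keeps a polynomial nearly integer-valued if it was so
before: one difference \<open>s - t\<close> of the values at the two states of a coordinate satisfies
\<open>int_dist_square_le_mix\<close>, which loses a factor that depends on that coordinate only. The constant
thus depends on \<open>S\<close> but not on the number of other variables, which makes the bound usable in the
limit of infinitely many coordinates.\<close>

lemma iterated_difference:
  assumes "finite S" "finite V" "S \<inter> V = {}" "\<And>i. 0 < p i \<and> p i < 1"
  shows "(\<Prod>i\<in>S. p i * (1 - p i) / 2) *
      cube_mean p V (\<lambda>U. (int_dist (walsh p (\<lambda>T. gap p S * b (S \<union> T)) V U))\<^sup>2)
    \<le> cube_mean p (S \<union> V) (\<lambda>U. (int_dist (walsh p b (S \<union> V) U))\<^sup>2)"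
  using assms(1-3)
proof (induction S arbitrary: V rule: finite_induct)
  case empty
  then show ?case by (simp add: gap_def)
next
  case (insert v S)
  let ?V = "insert v V"
  let ?a = "\<lambda>T. gap p S * b (S \<union> T)"
  let ?c = "\<lambda>T. gap p (insert v S) * b (insert v S \<union> T)"
  have V: "finite V" "v \<notin> V" "S \<inter> ?V = {}" using insert by auto
  have "p v * (1 - p v) / 2 * cube_mean p V (\<lambda>U. (int_dist (walsh p ?c V U))\<^sup>2)
      = cube_mean p V (\<lambda>U. p v * (1 - p v) / 2 * (int_dist (walsh p ?c V U))\<^sup>2)"
    by (rule cube_mean_scale[symmetric])
  also have "\<dots> \<le> cube_mean p ?V (\<lambda>U. (int_dist (walsh p ?a ?V U))\<^sup>2)"
    unfolding cube_mean_walsh_insert[OF V(1,2), where h = "\<lambda>t. (int_dist t)\<^sup>2"]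
  proof (rule cube_mean_mono)
    fix U
    let ?A = "walsh p ?a V U" and ?B = "walsh p (\<lambda>T. ?a (insert v T)) V U"
    have "?c = (\<lambda>T. (coin p v True - coin p v False) * ?a (insert v T))"
      using insert.hyps by (auto simp: gap_def coin_gap)
    then have "walsh p ?c V U = (coin p v True - coin p v False) * ?B"
      by (simp only: walsh_scale)
    also have "\<dots> = (?A + coin p v True * ?B) - (?A + coin p v False * ?B)"
      by (simp add: algebra_simps)
    finally have c: "walsh p ?c V U = (?A + coin p v True * ?B) - (?A + coin p v False * ?B)" .
    show "p v * (1 - p v) / 2 * (int_dist (walsh p ?c V U))\<^sup>2 \<le>
        p v * (int_dist (?A + coin p v True * ?B))\<^sup>2 + (1 - p v) * (int_dist (?A + coin p v False * ?B))\<^sup>2"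
      unfolding c
      using int_dist_square_le_mix[of "p v" "?A + coin p v True * ?B" "?A + coin p v False * ?B"]
        assms(4)[of v] by simp
  qed (use assms(4) in auto)
  finally have step: "p v * (1 - p v) / 2 * cube_mean p V (\<lambda>U. (int_dist (walsh p ?c V U))\<^sup>2)
      \<le> cube_mean p ?V (\<lambda>U. (int_dist (walsh p ?a ?V U))\<^sup>2)" .
  have pos: "0 \<le> (\<Prod>i\<in>S. p i * (1 - p i) / 2)"
    using assms(4) by (intro prod_nonneg) (auto simp: less_imp_le)
  have "(\<Prod>i\<in>insert v S. p i * (1 - p i) / 2) * cube_mean p V (\<lambda>U. (int_dist (walsh p ?c V U))\<^sup>2)
      = (\<Prod>i\<in>S. p i * (1 - p i) / 2) *
        (p v * (1 - p v) / 2 * cube_mean p V (\<lambda>U. (int_dist (walsh p ?c V U))\<^sup>2))"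
    using insert.hyps by simp
  also have "\<dots> \<le> (\<Prod>i\<in>S. p i * (1 - p i) / 2) *
      cube_mean p ?V (\<lambda>U. (int_dist (walsh p ?a ?V U))\<^sup>2)"
    by (rule mult_left_mono[OF step pos])
  also have "\<dots> \<le> cube_mean p (S \<union> ?V) (\<lambda>U. (int_dist (walsh p b (S \<union> ?V) U))\<^sup>2)"
    using insert.IH[of ?V] V by simp
  finally show ?case by simp
qed


lemma Ints_nonzero_square_ge_1:
  fixes t :: real
  assumes "t \<in> \<int>" "t \<noteq> 0" shows "t\<^sup>2 \<ge> 1"
  using Ints_nonzero_abs_ge1[OF assms] by (metis one_power2 power2_abs power_mono zero_le_one)

section \<open>The law of finitely many Rademacher coordinates\<close>

definition plus_set :: "(nat \<Rightarrow> 'a \<Rightarrow> real) \<Rightarrow> nat set \<Rightarrow> 'a \<Rightarrow> nat set" where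
  "plus_set X V x = {i \<in> V. X i x = 1}"

lemma plus_set_subset: "plus_set X V x \<in> Pow V"
  by (auto simp: plus_set_def)

context rademacher_sequence
begin

lemma p01: "0 < p k \<and> p k < 1"
  using p_pos p_less_1 by auto

lemma X_measurable [measurable]: "X k \<in> borel_measurable M"
  using indep by (auto simp: indep_vars_def)

lemma AE_signs: "AE x in M. \<forall>k. X k x = 1 \<or> X k x = - 1"
proof (subst AE_all_countable, rule allI)
  fix k
  have "prob {x \<in> space M. X k x = 1 \<or> X k x = - 1} =
      prob ({x \<in> space M. X k x = 1} \<union> {x \<in> space M. X k x = - 1})"
    by (rule arg_cong[where f = prob]) auto
  also have "\<dots> = prob {x \<in> space M. X k x = 1} + prob {x \<in> space M. X k x = - 1}"
    by (rule finite_measure_Union) auto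
  also have "\<dots> = 1" using prob_plus prob_minus by simp
  finally show "AE x in M. X k x = 1 \<or> X k x = - 1"
    by (subst prob_Collect_eq_1[symmetric]) auto
qed

lemma normalized_eq_coin:
  assumes "X k x = 1 \<or> X k x = - 1"
  shows "normalized p X k x = coin p k (X k x = 1)"
  using assms by (auto simp: normalized_def coin_def divide_simps)

lemma plus_set_measurable:
  assumes "finite V"
  shows "{x \<in> space M. plus_set X V x = U} \<in> sets M"
proof (cases "U \<subseteq> V")
  case True
  have "{x \<in> space M. plus_set X V x = U} = {x \<in> space M. \<forall>i\<in>V. X i x = 1 \<longleftrightarrow> i \<in> U}"
    using True by (auto simp: plus_set_def)
  then show ?thesis using assms by simp
next
  case False
  then have "{x \<in> space M. plus_set X V x = U} = {}" by (auto simp: plus_set_def)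
  then show ?thesis by (simp only: sets.empty_sets)
qed

lemma prob_plus_set:
  assumes "finite V" "U \<subseteq> V"
  shows "prob {x \<in> space M. plus_set X V x = U} = config_weight p V U"
proof (cases "V = {}")
  case True
  then show ?thesis using assms prob_space by (simp add: plus_set_def config_weight_def)
next
  case False
  define A where "A i = (if i \<in> U then {1} else - {1::real})" for i
  have "{x \<in> space M. plus_set X V x = U} = (\<Inter>i\<in>V. X i -` A i \<inter> space M)"
    using assms False by (auto simp: plus_set_def A_def split: if_splits)
  also have "prob \<dots> = (\<Prod>i\<in>V. prob (X i -` A i \<inter> space M))"
    using assms False by (intro indep_varsD[OF indep]) (auto simp: A_def)
  also have "\<dots> = config_weight p V U"
    unfolding config_weight_def
  proof (rule prod.cong[OF refl])
    fix i
    have plus: "prob (X i -` {1} \<inter> space M) = p i"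
      using prob_plus[of i] by (simp add: vimage_def Int_def conj_commute)
    have "X i -` (- {1}) \<inter> space M = space M - (X i -` {1} \<inter> space M)" by auto
    then have "prob (X i -` (- {1}) \<inter> space M) = 1 - p i"
      using plus by (simp add: prob_compl)
    then show "prob (X i -` A i \<inter> space M) = (if i \<in> U then p i else 1 - p i)"
      using plus by (simp add: A_def)
  qed
  finally show ?thesis .
qed

lemma has_expectation_plus_set:
  assumes "finite V"
  shows "has_bochner_integral M (\<lambda>x. g (plus_set X V x)) (cube_mean p V g)"
proof -
  let ?E = "\<lambda>U. {x \<in> space M. plus_set X V x = U}"
  have "has_bochner_integral M (\<lambda>x. \<Sum>U\<in>Pow V. indicator (?E U) x * g U)
      (\<Sum>U\<in>Pow V. prob (?E U) * g U)"
    using plus_set_measurable[OF assms]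
    by (intro has_bochner_integral_sum has_bochner_integral_mult_left has_bochner_integral_real_indicator)
       (auto simp: less_top[symmetric])
  also have "(\<Sum>U\<in>Pow V. prob (?E U) * g U) = cube_mean p V g"
    unfolding cube_mean_def by (intro sum.cong) (auto simp: prob_plus_set assms)
  also have "has_bochner_integral M (\<lambda>x. \<Sum>U\<in>Pow V. indicator (?E U) x * g U) (cube_mean p V g)
      \<longleftrightarrow> ?thesis"
  proof (rule has_bochner_integral_cong[OF refl _ refl])
    fix x assume "x \<in> space M"
    then have "(\<Sum>U\<in>Pow V. indicator (?E U) x * g U) =
        (\<Sum>U\<in>Pow V. if U = plus_set X V x then g U else 0)"
      by (intro sum.cong) auto
    also have "\<dots> = g (plus_set X V x)"
      using assms plus_set_subset[of X V x] by simp
    finally show "(\<Sum>U\<in>Pow V. indicator (?E U) x * g U) = g (plus_set X V x)" .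
  qed
  finally show ?thesis .
qed

lemma integrable_plus_set: "finite V \<Longrightarrow> integrable M (\<lambda>x. g (plus_set X V x) :: real)"
  using has_expectation_plus_set has_bochner_integral_iff by blast

lemma expectation_plus_set:
  "finite V \<Longrightarrow> expectation (\<lambda>x. g (plus_set X V x)) = cube_mean p V g"
  using has_expectation_plus_set has_bochner_integral_iff by blast

text \<open>Every configuration of finitely many coordinates has positive probability, so what holds almost
surely for a function of them holds at each point of the cube.\<close>

lemma AE_plus_setD:
  assumes "finite V" "AE x in M. Q (plus_set X V x)" "U \<subseteq> V"
  shows "Q U"
proof (rule ccontr)
  assume "\<not> Q U"
  from assms(2) have "AE x in M. plus_set X V x \<noteq> U"
    by eventually_elim (use \<open>\<not> Q U\<close> in auto)
  then have "prob {x \<in> space M. plus_set X V x = U} = 0"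
    using plus_set_measurable[OF assms(1)] by (simp add: prob_Collect_eq_0)
  moreover have "config_weight p V U > 0" by (rule config_weight_pos) (simp add: p01)
  ultimately show False using assms by (simp add: prob_plus_set)
qed

lemma integrable_square_diff:
  fixes F :: "'a \<Rightarrow> real"
  assumes [measurable]: "F \<in> borel_measurable M" and F: "integrable M (\<lambda>x. (F x)\<^sup>2)" and "finite V"
  shows "integrable M (\<lambda>x. (F x - g (plus_set X V x))\<^sup>2)"
proof (rule Bochner_Integration.integrable_bound)
  show "integrable M (\<lambda>x. 2 * (F x)\<^sup>2 + 2 * (g (plus_set X V x))\<^sup>2)"
    using F integrable_plus_set[OF assms(3), of "\<lambda>U. (g U)\<^sup>2"] by simp
  have [measurable]: "(\<lambda>x. g (plus_set X V x)) \<in> borel_measurable M"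
    using integrable_plus_set[OF assms(3)] by blast
  show "(\<lambda>x. (F x - g (plus_set X V x))\<^sup>2) \<in> borel_measurable M" by measurable
  have "(a - b)\<^sup>2 \<le> 2 * a\<^sup>2 + 2 * b\<^sup>2" for a b :: real
    using zero_le_power2[of "a + b"] by (simp add: power2_eq_square algebra_simps)
  then show "AE x in M. norm ((F x - g (plus_set X V x))\<^sup>2)
      \<le> norm (2 * (F x)\<^sup>2 + 2 * (g (plus_set X V x))\<^sup>2)"
    by auto
qed

end

section \<open>Chaos kernels as Walsh coefficients\<close>

text \<open>A symmetric kernel that vanishes off the distinct tuples is a function of the underlying set, and
each set of size \<open>d\<close> carries \<open>d!\<close> equal terms of the multiple sum. These terms are collected
into one coefficient.\<close>

definition walsh_coeff :: "nat \<Rightarrow> (nat list \<Rightarrow> real) \<Rightarrow> nat set \<Rightarrow> real" where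
  "walsh_coeff d f T = (if card T = d then fact d * f (sorted_list_of_set T) else 0)"

lemma chaos_kernel_distinct:
  assumes "chaos_kernel d f" "is \<in> tuples d" "distinct is"
  shows "walsh_coeff d f (set is) = fact d * f is"
proof -
  have "card (set is) = d" using assms by (simp add: distinct_card tuples_def)
  moreover have "sorted_list_of_set (set is) \<in> tuples d"
    using calculation by (simp add: tuples_def)
  moreover have "mset (sorted_list_of_set (set is)) = mset is"
    using assms(3) by (subst set_eq_iff_mset_eq_distinct[symmetric]) auto
  ultimately show ?thesis using assms unfolding walsh_coeff_def chaos_kernel_def by metis
qed

text \<open>A set of \<open>m\<close> elements is listed without repetition in \<open>m!\<close> ways; these lists contribute equally.\<close>

lemma sum_distinct_lists:
  fixes h :: "nat list \<Rightarrow> real"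
  assumes "finite V"
    and "\<And>is. is \<in> tuples m \<Longrightarrow> set is \<subseteq> V \<Longrightarrow> \<not> distinct is \<Longrightarrow> h is = 0"
    and "\<And>is. is \<in> tuples m \<Longrightarrow> set is \<subseteq> V \<Longrightarrow> distinct is \<Longrightarrow> h is = g (set is)"
  shows "(\<Sum>is\<in>{is \<in> tuples m. set is \<subseteq> V}. h is) = (\<Sum>T\<in>Pow V. if card T = m then fact m * g T else 0)"
proof -
  let ?L = "{is \<in> tuples m. set is \<subseteq> V}"
  have fin: "finite ?L"
    using finite_lists_length_eq[OF assms(1), of m] by (simp add: tuples_def conj_commute)
  have "(\<Sum>is\<in>?L. h is) = (\<Sum>T\<in>Pow V. \<Sum>is\<in>{is \<in> ?L. set is = T}. h is)"
    using assms(1) fin by (intro sum.group[symmetric]) auto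
  also have "\<dots> = (\<Sum>T\<in>Pow V. if card T = m then fact m * g T else 0)"
  proof (rule sum.cong[OF refl])
    fix T assume T: "T \<in> Pow V"
    then have finT: "finite T" using assms(1) finite_subset by auto
    have nd: "h is = 0" if "is \<in> ?L" "set is = T" "card T \<noteq> m \<or> is \<notin> permutations_of_set T" for "is"
      using assms(2)[of "is"] that distinct_card[of "is"]
      by (auto simp: tuples_def permutations_of_set_def)
    show "(\<Sum>is\<in>{is \<in> ?L. set is = T}. h is) = (if card T = m then fact m * g T else 0)"
    proof (cases "card T = m")
      case True
      have sub: "permutations_of_set T \<subseteq> {is \<in> ?L. set is = T}"
        using T True by (auto simp: permutations_of_set_def tuples_def distinct_card)
      have "(\<Sum>is\<in>{is \<in> ?L. set is = T}. h is) = (\<Sum>is\<in>permutations_of_set T. h is)"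
        by (rule sum.mono_neutral_right[OF finite_subset[OF _ fin] sub]) (auto intro: nd)
      also have "\<dots> = (\<Sum>is\<in>permutations_of_set T. g T)"
      proof (rule sum.cong[OF refl])
        fix "is" assume "is": "is \<in> permutations_of_set T"
        then have "is \<in> tuples m" "set is = T" using sub by auto
        then show "h is = g T"
          using assms(3)[of "is"] T permutations_of_setD(2)[OF "is"] by auto
      qed
      also have "\<dots> = fact m * g T" using finT True by simp
      finally show ?thesis using True by simp
    next
      case False
      then show ?thesis using nd by (auto intro: sum.neutral)
    qed
  qed
  finally show ?thesis .
qed


context rademacher_sequence
begin

lemma chaos_partial_sum_walsh:
  assumes "chaos_kernel d f" "finite V" "\<forall>k. X k x = 1 \<or> X k x = - 1"
  shows "chaos_partial_sum f (normalized p X) {is \<in> tuples d. set is \<subseteq> V} x =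
    walsh p (walsh_coeff d f) V (plus_set X V x)"
proof -
  let ?g = "\<lambda>T. walsh_coeff d f T / fact d * (\<Prod>i\<in>T. coin p i (i \<in> plus_set X V x))"
  have "chaos_partial_sum f (normalized p X) {is \<in> tuples d. set is \<subseteq> V} x =
      (\<Sum>T\<in>Pow V. if card T = d then fact d * ?g T else 0)"
    unfolding chaos_partial_sum_def
  proof (rule sum_distinct_lists[OF assms(2)])
    fix "is" assume "is": "is \<in> tuples d" "set is \<subseteq> V" "\<not> distinct is"
    then have "f is = 0" using assms(1) unfolding chaos_kernel_def by blast
    then show "f is * (\<Prod>i\<leftarrow>is. normalized p X i x) = 0" by simp
  next
    fix "is" assume "is": "is \<in> tuples d" "set is \<subseteq> V" "distinct is"
    have "(\<Prod>i\<leftarrow>is. normalized p X i x) = (\<Prod>i\<in>set is. normalized p X i x)"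
      using "is"(3) by (simp add: prod.distinct_set_conv_list)
    also have "\<dots> = (\<Prod>i\<in>set is. coin p i (i \<in> plus_set X V x))"
      using "is"(2) assms(3)
      by (intro prod.cong refl) (auto simp: plus_set_def normalized_eq_coin)
    finally show "f is * (\<Prod>i\<leftarrow>is. normalized p X i x) = ?g (set is)"
      using chaos_kernel_distinct[OF assms(1) "is"(1,3)] by simp
  qed
  also have "\<dots> = walsh p (walsh_coeff d f) V (plus_set X V x)"
    unfolding walsh_def by (intro sum.cong) (auto simp: walsh_coeff_def)
  finally show ?thesis .
qed

text \<open>The finite partial sums over tuples with entries below \<open>n\<close> are cofinal in the net of all finite
partial sums, and each of them is a multilinear polynomial in the first \<open>n\<close> coordinates.\<close>

lemma chaos_L2_limit:
  assumes "in_rademacher_chaos M X p d f F"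
  shows "(\<lambda>n. expectation (\<lambda>x. (F x - walsh p (walsh_coeff d f) {..<n} (plus_set X {..<n} x))\<^sup>2))
    \<longlonglongrightarrow> 0"
proof -
  have ker: "chaos_kernel d f"
    and lim: "((\<lambda>A. expectation (\<lambda>x. (F x - chaos_partial_sum f (normalized p X) A x)\<^sup>2)) \<longlongrightarrow> 0)
       (finite_subsets_at_top (tuples d))" and [measurable]: "F \<in> borel_measurable M"
    using assms by (auto simp: in_rademacher_chaos_def is_chaos_sum_def)
  let ?A = "\<lambda>n. {is \<in> tuples d. set is \<subseteq> {..<n}}"
  have "filterlim ?A (finite_subsets_at_top (tuples d)) sequentially"
    unfolding filterlim_finite_subsets_at_top
  proof (intro allI impI)
    fix L assume L: "finite L \<and> L \<subseteq> tuples d"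
    then have "finite (\<Union>(set ` L))" by auto
    then obtain N where N: "\<Union>(set ` L) \<subseteq> {..<N}"
      using finite_nat_bounded by blast
    have "finite (?A n)" for n
      using finite_lists_length_eq[of "{..<n}" d] by (simp add: tuples_def conj_commute)
    moreover have "L \<subseteq> ?A n" if "n \<ge> N" for n
    proof
      fix "is" assume "is": "is \<in> L"
      then have "set is \<subseteq> {..<N}" using N by blast
      also have "\<dots> \<subseteq> {..<n}" using that by auto
      finally show "is \<in> ?A n" using L "is" by auto
    qed
    ultimately show "\<forall>\<^sub>F n in sequentially. finite (?A n) \<and> L \<subseteq> ?A n \<and> ?A n \<subseteq> tuples d"
      by (auto simp: eventually_sequentially)
  qed
  from filterlim_compose[OF lim this]
  have "(\<lambda>n. expectation (\<lambda>x. (F x - chaos_partial_sum f (normalized p X) (?A n) x)\<^sup>2)) \<longlonglongrightarrow> 0" .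
  moreover have "(\<lambda>n. expectation (\<lambda>x. (F x - chaos_partial_sum f (normalized p X) (?A n) x)\<^sup>2)) =
      (\<lambda>n. expectation (\<lambda>x. (F x - walsh p (walsh_coeff d f) {..<n} (plus_set X {..<n} x))\<^sup>2))"
  proof (rule ext, rule integral_cong_AE)
    fix n
    have [measurable]: "(\<lambda>x. walsh p (walsh_coeff d f) {..<n} (plus_set X {..<n} x)) \<in> borel_measurable M"
      using integrable_plus_set[of "{..<n}" "walsh p (walsh_coeff d f) {..<n}"] by auto
    show "(\<lambda>x. (F x - walsh p (walsh_coeff d f) {..<n} (plus_set X {..<n} x))\<^sup>2) \<in> borel_measurable M"
      by measurable
    have [measurable]: "normalized p X k \<in> borel_measurable M" for k
      unfolding normalized_def by measurable
    have [measurable]: "(\<lambda>x. \<Prod>i\<leftarrow>is. normalized p X i x) \<in> borel_measurable M" for "is"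
      by (induction "is") auto
    show "(\<lambda>x. (F x - chaos_partial_sum f (normalized p X) (?A n) x)\<^sup>2) \<in> borel_measurable M"
      unfolding chaos_partial_sum_def by measurable
    show "AE x in M. (F x - chaos_partial_sum f (normalized p X) (?A n) x)\<^sup>2 =
        (F x - walsh p (walsh_coeff d f) {..<n} (plus_set X {..<n} x))\<^sup>2"
      using AE_signs by eventually_elim (simp add: chaos_partial_sum_walsh[OF ker])
  qed
  ultimately show ?thesis by (simp only:)
qed

section \<open>Integrality of the leading coefficients\<close>

text \<open>The polynomials \<open>P\<^sub>n\<close> in the first \<open>n\<close> coordinates converge to \<open>F\<close> in mean square, and
\<open>F + \<theta>\<close> is an integer, so the mean square distance of \<open>P\<^sub>n + \<theta>\<close> to the integers tends to \<open>0\<close>.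
Differencing \<open>P\<^sub>n + \<theta>\<close> in the \<open>d\<close> coordinates of \<open>S\<close> kills every term except the one of \<open>S\<close>,
since \<open>P\<^sub>n\<close> is homogeneous of degree \<open>d\<close>; what is left is a constant that does not depend on
\<open>n\<close>. By \<open>iterated_difference\<close> its distance to the integers is at most a multiple of a
null sequence, hence zero.\<close>

lemma scaled_walsh_coeff_integer:
  assumes chaos: "in_rademacher_chaos M X p d f F" and "d \<ge> 1"
    and int: "AE x in M. F x + \<theta> \<in> \<int>" and S: "finite S" "card S = d"
  shows "gap p S * walsh_coeff d f S \<in> \<int>"
proof -
  \<comment> \<open>The shift \<open>\<theta>\<close> is the constant coefficient; the slot is free because \<open>d \<ge> 1\<close>.\<close>
  let ?c = "walsh_coeff d f" and ?b = "(walsh_coeff d f)({} := \<theta>)"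
  let ?z = "int_dist (gap p S * ?c S)"
  let ?\<mu> = "\<Prod>i\<in>S. p i * (1 - p i) / 2"
  let ?err = "\<lambda>n. expectation (\<lambda>x. (F x - walsh p ?c {..<n} (plus_set X {..<n} x))\<^sup>2)"
  have F [measurable]: "F \<in> borel_measurable M" "integrable M (\<lambda>x. (F x)\<^sup>2)"
    using chaos by (auto simp: in_rademacher_chaos_def is_chaos_sum_def)
  have c0: "?c {} = 0" using \<open>d \<ge> 1\<close> by (simp add: walsh_coeff_def)
  have Sne: "S \<noteq> {}" using S \<open>d \<ge> 1\<close> by auto
  have bound: "?\<mu> * ?z\<^sup>2 \<le> ?err n" if n: "S \<subseteq> {..<n}" for n
  proof -
    let ?V = "{..<n} - S"
    have walsh_top: "walsh p (\<lambda>T. gap p S * ?b (S \<union> T)) ?V U = gap p S * ?c S" for U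
    proof -
      have "?b (S \<union> T) = 0" if "T \<subseteq> ?V" "T \<noteq> {}" for T
      proof -
        have "finite T" using that(1) finite_subset by blast
        then have "card (S \<union> T) = card S + card T" using that S by (intro card_Un_disjoint) auto
        then have "card (S \<union> T) \<noteq> d" using S that \<open>finite T\<close> by simp
        then show ?thesis using Sne by (simp add: walsh_coeff_def)
      qed
      then have "walsh p (\<lambda>T. gap p S * ?b (S \<union> T)) ?V U =
          (\<Sum>T\<in>{{}}. gap p S * ?b (S \<union> T) * (\<Prod>i\<in>T. coin p i (i \<in> U)))"
        unfolding walsh_def by (intro sum.mono_neutral_right) auto
      then show ?thesis using Sne by simp
    qed
    have shift: "walsh p ?b {..<n} U = walsh p ?c {..<n} U + \<theta>" for U
    proof -
      have "walsh p ?b {..<n} U = (\<Sum>T\<in>Pow {..<n}. ?c T * (\<Prod>i\<in>T. coin p i (i \<in> U)) +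
          (if T = {} then \<theta> else 0))"
        unfolding walsh_def using c0 by (intro sum.cong) auto
      then show ?thesis by (simp add: walsh_def sum.distrib)
    qed
    have "?\<mu> * ?z\<^sup>2 = ?\<mu> * cube_mean p ?V (\<lambda>U. (int_dist (walsh p (\<lambda>T. gap p S * ?b (S \<union> T)) ?V U))\<^sup>2)"
      unfolding walsh_top by (simp add: cube_mean_const)
    also have "\<dots> \<le> cube_mean p (S \<union> ?V) (\<lambda>U. (int_dist (walsh p ?b (S \<union> ?V) U))\<^sup>2)"
      using S p01 by (intro iterated_difference) auto
    also have "S \<union> ?V = {..<n}" using n by auto
    also have "cube_mean p {..<n} (\<lambda>U. (int_dist (walsh p ?b {..<n} U))\<^sup>2) =
        expectation (\<lambda>x. (int_dist (walsh p ?c {..<n} (plus_set X {..<n} x) + \<theta>))\<^sup>2)"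
      unfolding shift
      by (rule expectation_plus_set[where g = "\<lambda>U. (int_dist (walsh p ?c {..<n} U + \<theta>))\<^sup>2", symmetric]) simp
    also have "\<dots> \<le> ?err n"
    proof (rule integral_mono_AE)
      show "integrable M (\<lambda>x. (int_dist (walsh p ?c {..<n} (plus_set X {..<n} x) + \<theta>))\<^sup>2)"
        by (rule integrable_plus_set[where g = "\<lambda>U. (int_dist (walsh p ?c {..<n} U + \<theta>))\<^sup>2"]) simp
      show "integrable M (\<lambda>x. (F x - walsh p ?c {..<n} (plus_set X {..<n} x))\<^sup>2)"
        using F by (intro integrable_square_diff) auto
      show "AE x in M. (int_dist (walsh p ?c {..<n} (plus_set X {..<n} x) + \<theta>))\<^sup>2 \<le>
          (F x - walsh p ?c {..<n} (plus_set X {..<n} x))\<^sup>2"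
        using int
      proof eventually_elim
        case (elim x)
        let ?w = "walsh p ?c {..<n} (plus_set X {..<n} x)"
        have "int_dist (?w + \<theta>) \<le> \<bar>F x - ?w\<bar>"
          using int_dist_le[OF elim, of "?w + \<theta>"] by (simp add: abs_minus_commute)
        then show ?case using int_dist_nonneg by (metis power2_abs power_mono)
      qed
    qed
    finally show ?thesis .
  qed
  obtain N where N: "S \<subseteq> {..<N}" using S(1) finite_nat_bounded by blast
  have "?\<mu> * ?z\<^sup>2 \<le> 0"
  proof (rule LIMSEQ_le_const[OF chaos_L2_limit[OF chaos]])
    show "\<exists>N. \<forall>n\<ge>N. ?\<mu> * ?z\<^sup>2 \<le> ?err n"
    proof (intro exI[of _ N] allI impI bound)
      fix n assume "N \<le> n"
      then have "{..<N} \<subseteq> {..<n}" by auto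
      with N show "S \<subseteq> {..<n}" by (rule order_trans)
    qed
  qed
  moreover have "?\<mu> > 0" using p01 by (intro prod_pos) auto
  ultimately have "?z = 0" by (auto simp: mult_le_0_iff)
  then show ?thesis by (rule int_dist_eq_0)
qed

end


section \<open>Influences in terms of the coefficients\<close>

text \<open>By symmetry, a nonzero value of the kernel on a tuple containing \<open>k\<close> gives a nonzero value on a
tuple ending in \<open>k\<close>, which is one of the terms of the influence.\<close>

lemma influence_pos:
  assumes ker: "chaos_kernel d f" and "d \<ge> 1"
    and "is": "is \<in> tuples d" "f is \<noteq> 0" "k \<in> set is"
  shows "influence d f k > 0"
proof (rule ccontr)
  assume "\<not> influence d f k > 0"
  then have le: "(\<Sum>\<^sub>\<infinity>is\<in>tuples (d - 1). (f (is @ [k]))\<^sup>2) \<le> 0"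
    by (simp add: influence_def)
  let ?js = "remove1 k is"
  have js: "?js \<in> tuples (d - 1)" "?js @ [k] \<in> tuples d"
    using "is" \<open>d \<ge> 1\<close> by (auto simp: tuples_def length_remove1)
  have "mset (?js @ [k]) = mset is" using "is"(3) by simp
  then have "f (?js @ [k]) = f is" using ker js "is"(1) unfolding chaos_kernel_def by blast
  moreover have "(\<lambda>is. (f (is @ [k]))\<^sup>2) summable_on tuples (d - 1)"
  proof -
    have inj: "inj_on (\<lambda>is. is @ [k]) (tuples (d - 1))" by (auto simp: inj_on_def)
    have "(\<lambda>is. (f is)\<^sup>2) summable_on tuples d" using ker unfolding chaos_kernel_def by blast
    then have "(\<lambda>is. (f is)\<^sup>2) summable_on (\<lambda>is. is @ [k]) ` tuples (d - 1)"
      by (rule summable_on_subset_banach) (use \<open>d \<ge> 1\<close> in \<open>auto simp: tuples_def\<close>)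
    then show ?thesis unfolding summable_on_reindex[OF inj] o_def .
  qed
  then have "(f (?js @ [k]))\<^sup>2 = 0"
    using nonneg_infsum_le_0D[OF le _ _ js(1)] by simp
  ultimately show False using "is"(2) by simp
qed

text \<open>The factor \<open>d d!\<close> turns the influence into a sum of squared coefficients: a set
\<open>T \<union> {k}\<close> comes from \<open>(d - 1)!\<close> tuples ending in \<open>k\<close>, each contributing
\<open>(coefficient / d!)\<^sup>2\<close>, and \<open>d d! (d - 1)! = (d!)\<^sup>2\<close>. By Parseval, the sum is the second moment of
the polynomial that multiplies \<open>Y\<^sub>k\<close>.\<close>

lemma influence_walsh_coeff:
  assumes ker: "chaos_kernel d f" and d: "d \<ge> 1" and V: "finite V"
    and supp: "\<And>is. is \<in> tuples d \<Longrightarrow> f is \<noteq> 0 \<Longrightarrow> set is \<subseteq> V"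
  shows "real d * fact d * influence d f k = (\<Sum>T\<in>Pow (V - {k}). (walsh_coeff d f (insert k T))\<^sup>2)"
proof -
  let ?L = "{is \<in> tuples (d - 1). set is \<subseteq> V - {k}}"
  let ?g = "\<lambda>T. (walsh_coeff d f (insert k T) / fact d)\<^sup>2"
  have mem: "is @ [k] \<in> tuples d" if "is \<in> tuples (d - 1)" for "is"
    using that d by (auto simp: tuples_def)
  have nondistinct: "f js = 0" if "js \<in> tuples d" "\<not> distinct js" for js
    using ker that unfolding chaos_kernel_def by blast
  have "influence d f k = (\<Sum>\<^sub>\<infinity>is\<in>?L. (f (is @ [k]))\<^sup>2)"
    unfolding influence_def
  proof (rule infsum_cong_neutral)
    fix "is" assume "is": "is \<in> tuples (d - 1) - ?L"
    have "f (is @ [k]) = 0"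
    proof (rule ccontr)
      assume "f (is @ [k]) \<noteq> 0"
      then have "set (is @ [k]) \<subseteq> V" "distinct (is @ [k])"
        using supp[OF mem] nondistinct[OF mem] "is" by blast+
      then show False using "is" by auto
    qed
    then show "(f (is @ [k]))\<^sup>2 = 0" by simp
  qed auto
  also have "\<dots> = (\<Sum>is\<in>?L. (f (is @ [k]))\<^sup>2)"
    using finite_lists_length_eq[of "V - {k}" "d - 1"] V
    by (intro infsum_finite) (simp add: tuples_def conj_commute)
  also have "\<dots> = (\<Sum>T\<in>Pow (V - {k}). if card T = d - 1 then fact (d - 1) * ?g T else 0)"
  proof (rule sum_distinct_lists)
    fix "is" assume "is": "is \<in> tuples (d - 1)" "set is \<subseteq> V - {k}" "\<not> distinct is"
    then show "(f (is @ [k]))\<^sup>2 = 0" using nondistinct[OF mem] by simp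
  next
    fix "is" assume "is": "is \<in> tuples (d - 1)" "set is \<subseteq> V - {k}" "distinct is"
    then have "distinct (is @ [k])" by auto
    then show "(f (is @ [k]))\<^sup>2 = ?g (set is)"
      using chaos_kernel_distinct[OF ker mem[OF "is"(1)]] by simp
  qed (use V in auto)
  also have "\<dots> = (\<Sum>T\<in>Pow (V - {k}). fact (d - 1) * ?g T)"
  proof (rule sum.cong[OF refl])
    fix T assume "T \<in> Pow (V - {k})"
    then have "finite T" "k \<notin> T" using V finite_subset by auto
    then have "card (insert k T) = Suc (card T)" by simp
    then show "(if card T = d - 1 then fact (d - 1) * ?g T else 0) = fact (d - 1) * ?g T"
      using d by (auto simp: walsh_coeff_def)
  qed
  finally have "real d * fact d * influence d f k =
      (\<Sum>T\<in>Pow (V - {k}). real d * fact d * (fact (d - 1) * ?g T))"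
    by (simp add: sum_distrib_left)
  also have "\<dots> = (\<Sum>T\<in>Pow (V - {k}). (walsh_coeff d f (insert k T))\<^sup>2)"
  proof (rule sum.cong[OF refl])
    fix T
    have "real d * fact (d - 1) = fact d" using d by (simp add: fact_reduce)
    moreover have "real d * fact d * (fact (d - 1) * ?g T) = fact d * (real d * fact (d - 1)) * ?g T"
      by (simp only: mult_ac)
    ultimately have "real d * fact d * (fact (d - 1) * ?g T) = (fact d)\<^sup>2 * ?g T"
      by (simp only: power2_eq_square)
    also have "\<dots> = (walsh_coeff d f (insert k T))\<^sup>2" by (simp add: power_divide)
    finally show "real d * fact d * (fact (d - 1) * ?g T) = (walsh_coeff d f (insert k T))\<^sup>2" .
  qed
  finally show ?thesis .
qed

section \<open>Integer-valued elements of a chaos\<close>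

lemma finite_large_terms:
  fixes g :: "'b \<Rightarrow> real"
  assumes "g summable_on A" "\<eta> > 0" "\<And>x. x \<in> B \<Longrightarrow> g x \<ge> \<eta>" "B \<subseteq> A"
  shows "finite B"
proof -
  have sum: "g summable_on B" by (rule summable_on_subset_banach[OF assms(1,4)])
  have "card G \<le> nat \<lfloor>infsum g B / \<eta>\<rfloor>" if "G \<subseteq> B" "finite G" for G
  proof -
    have "real (card G) * \<eta> \<le> (\<Sum>x\<in>G. g x)"
      using assms(3) that(1) by (intro sum_bounded_below) auto
    also have "\<dots> \<le> infsum g B"
    proof (rule finite_sum_le_infsum[OF sum that(2,1)])
      show "0 \<le> g x" if "x \<in> B - G" for x using assms(2) assms(3)[of x] that by simp
    qed
    finally show ?thesis using assms(2) by (intro le_nat_floor) (simp add: pos_le_divide_eq)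
  qed
  then show ?thesis using finite_if_finite_subsets_card_bdd by blast
qed

lemma bernoulli_variance_ge:
  fixes q :: real
  assumes "\<epsilon> \<le> q" "q \<le> 1 - \<epsilon>"
  shows "q * (1 - q) \<ge> \<epsilon> * (1 - \<epsilon>)"
proof -
  have "0 \<le> (q - \<epsilon>) * (1 - \<epsilon> - q)" using assms by simp
  then show ?thesis by (simp add: algebra_simps)
qed

text \<open>Values in \<open>\<int>\<close> are the common setting of the bounds for variables with values in \<open>\<nat>\<close> and of the
sequences with values in \<open>\<int>\<close>: the argument works with differences of values of \<open>F + \<theta>\<close>, which are
integers in both cases.\<close>

locale integer_chaos = rademacher_sequence M X p for M :: "'a measure" and X p +
  fixes d :: nat and f :: "nat list \<Rightarrow> real" and F :: "'a \<Rightarrow> real" and \<theta> \<epsilon> :: real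
  assumes chaos: "in_rademacher_chaos M X p d f F"
    and degree_pos: "d \<ge> 1"
    and integer_valued: "AE x in M. F x + \<theta> \<in> \<int>"
    and eps_pos: "0 < \<epsilon>" and eps_le: "\<epsilon> \<le> 1/2"
    and p_bounds: "\<And>k. influence d f k > 0 \<Longrightarrow> \<epsilon> \<le> p k \<and> p k \<le> 1 - \<epsilon>"
begin

abbreviation "c \<equiv> walsh_coeff d f"

definition "coords = {k. influence d f k > 0}"

lemma kernel: "chaos_kernel d f"
  using chaos by (simp add: in_rademacher_chaos_def)

lemma F_square_integrable: "F \<in> borel_measurable M" "integrable M (\<lambda>x. (F x)\<^sup>2)"
  using chaos by (auto simp: in_rademacher_chaos_def is_chaos_sum_def)

lemma kernel_support:
  assumes "is \<in> tuples d" "f is \<noteq> 0"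
  shows "set is \<subseteq> coords" "distinct is"
  using influence_pos[OF kernel degree_pos assms] kernel assms
  unfolding coords_def chaos_kernel_def by blast+

lemma c_support:
  assumes "c T \<noteq> 0"
  shows "T \<subseteq> coords" "card T = d" "finite T"
proof -
  show card: "card T = d" using assms by (auto simp: walsh_coeff_def split: if_splits)
  then show fin: "finite T" using degree_pos card.infinite by fastforce
  have "f (sorted_list_of_set T) \<noteq> 0"
  proof
    assume "f (sorted_list_of_set T) = 0"
    then have "c T = 0" by (simp add: walsh_coeff_def)
    then show False using assms by simp
  qed
  then show "T \<subseteq> coords"
    using kernel_support(1)[of "sorted_list_of_set T"] card fin by (auto simp: tuples_def)
qed

text \<open>The leading coefficients are integers up to the factor \<open>gap\<close>, so a nonzero value of the kernel is
bounded away from zero. A square-summable kernel can have only finitely many such values.\<close>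

lemma finite_kernel_support: "finite {is \<in> tuples d. f is \<noteq> 0}"
proof (rule finite_large_terms)
  show "(\<lambda>is. (f is)\<^sup>2) summable_on tuples d"
    using kernel unfolding chaos_kernel_def by blast
  show "0 < (\<epsilon> * (1 - \<epsilon>)) ^ d / (fact d)\<^sup>2"
    using eps_pos eps_le by simp
  fix "is" assume "is \<in> {is \<in> tuples d. f is \<noteq> 0}"
  then have "is": "is \<in> tuples d" "f is \<noteq> 0" by auto
  let ?S = "set is" and ?P = "\<Prod>i\<in>set is. p i * (1 - p i)"
  note S = kernel_support[OF "is"]
  have card: "card ?S = d" using S(2) "is"(1) by (simp add: distinct_card tuples_def)
  have cS: "c ?S = fact d * f is" by (rule chaos_kernel_distinct[OF kernel "is"(1) S(2)])
  have Ppos: "?P > 0" using p01 by (intro prod_pos) auto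
  have gap_sq: "(gap p ?S)\<^sup>2 = 1 / ?P"
  proof -
    have "(1 / sqrt (p i * (1 - p i)))\<^sup>2 = 1 / (p i * (1 - p i))" for i
      using p01[of i] by (simp add: power_divide)
    then have "(gap p ?S)\<^sup>2 = (\<Prod>i\<in>?S. 1 / (p i * (1 - p i)))"
      by (simp only: gap_def prod_power_distrib)
    then show ?thesis by (simp add: prod_dividef)
  qed
  have "(gap p ?S)\<^sup>2 > 0" unfolding gap_sq by (rule divide_pos_pos[OF zero_less_one Ppos])
  then have "gap p ?S \<noteq> 0" by auto
  then have "(gap p ?S * c ?S)\<^sup>2 \<ge> 1"
    using scaled_walsh_coeff_integer[OF chaos degree_pos integer_valued _ card] cS "is"(2)
    by (intro Ints_nonzero_square_ge_1) auto
  then have "?P \<le> (c ?S)\<^sup>2" using Ppos gap_sq by (simp add: power_mult_distrib field_simps)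
  moreover have "(\<epsilon> * (1 - \<epsilon>)) ^ d \<le> ?P"
  proof -
    have "(\<Prod>i\<in>?S. \<epsilon> * (1 - \<epsilon>)) \<le> ?P"
    proof (rule prod_mono)
      fix i assume "i \<in> ?S"
      then have "\<epsilon> \<le> p i \<and> p i \<le> 1 - \<epsilon>" using S(1) p_bounds by (auto simp: coords_def)
      then show "0 \<le> \<epsilon> * (1 - \<epsilon>) \<and> \<epsilon> * (1 - \<epsilon>) \<le> p i * (1 - p i)"
        using eps_pos eps_le bernoulli_variance_ge by auto
    qed
    then show ?thesis using card by simp
  qed
  ultimately have "(\<epsilon> * (1 - \<epsilon>)) ^ d \<le> (fact d * f is)\<^sup>2" using cS by simp
  then show "(\<epsilon> * (1 - \<epsilon>)) ^ d / (fact d)\<^sup>2 \<le> (f is)\<^sup>2"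
    by (simp add: power_mult_distrib field_simps)
qed auto

lemma coords_eq: "coords = (\<Union>is\<in>{is \<in> tuples d. f is \<noteq> 0}. set is)"
proof
  show "(\<Union>is\<in>{is \<in> tuples d. f is \<noteq> 0}. set is) \<subseteq> coords"
    using kernel_support(1) by auto
  show "coords \<subseteq> (\<Union>is\<in>{is \<in> tuples d. f is \<noteq> 0}. set is)"
  proof (rule ccontr)
    assume "\<not> ?thesis"
    then obtain k where k: "influence d f k > 0" "\<And>is. is \<in> tuples d \<Longrightarrow> f is \<noteq> 0 \<Longrightarrow> k \<notin> set is"
      by (auto simp: coords_def)
    have "f (is @ [k]) = 0" if "is \<in> tuples (d - 1)" for "is"
      using k(2)[of "is @ [k]"] that degree_pos by (auto simp: tuples_def)
    then have "influence d f k = (\<Sum>\<^sub>\<infinity>is\<in>tuples (d - 1). 0)"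
      unfolding influence_def by (intro infsum_cong) simp
    then show False using k(1) by simp
  qed
qed

lemma finite_coords: "finite coords"
  unfolding coords_eq using finite_kernel_support by auto

text \<open>The approximating polynomials are eventually constant, so the limit in mean square equals that
polynomial. From here on everything happens on a finite cube.\<close>

lemma F_eq_walsh: "AE x in M. F x = walsh p c coords (plus_set X coords x)"
proof -
  let ?G = "\<lambda>x. walsh p c coords (plus_set X coords x)"
  obtain N where N: "coords \<subseteq> {..<N}" using finite_coords finite_nat_bounded by blast
  have eq: "walsh p c {..<n} (plus_set X {..<n} x) = ?G x" if "n \<ge> N" for n x
  proof (rule walsh_support)
    show "coords \<subseteq> {..<n}" using N that by auto
    then show "plus_set X {..<n} x \<inter> coords = plus_set X coords x \<inter> coords"
      by (auto simp: plus_set_def)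
  qed (use c_support in auto)
  have "(\<lambda>n. expectation (\<lambda>x. (F x - ?G x)\<^sup>2)) \<longlonglongrightarrow> 0"
  proof (rule Lim_transform_eventually[OF chaos_L2_limit[OF chaos]])
    show "\<forall>\<^sub>F n in sequentially.
        expectation (\<lambda>x. (F x - walsh p c {..<n} (plus_set X {..<n} x))\<^sup>2) =
        expectation (\<lambda>x. (F x - ?G x)\<^sup>2)"
      using eventually_ge_at_top[of N] by eventually_elim (simp only: eq)
  qed
  then have "expectation (\<lambda>x. (F x - ?G x)\<^sup>2) = 0"
    using LIMSEQ_unique tendsto_const by blast
  moreover have "integrable M (\<lambda>x. (F x - ?G x)\<^sup>2)"
    by (intro integrable_square_diff F_square_integrable finite_coords)
  ultimately have "AE x in M. (F x - ?G x)\<^sup>2 = 0"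
    by (subst (asm) integral_nonneg_eq_0_iff_AE) auto
  then show ?thesis by eventually_elim simp
qed

lemma walsh_integer:
  assumes "U \<subseteq> coords" shows "walsh p c coords U + \<theta> \<in> \<int>"
proof (rule AE_plus_setD[OF finite_coords _ assms])
  show "AE x in M. walsh p c coords (plus_set X coords x) + \<theta> \<in> \<int>"
    using F_eq_walsh integer_valued by eventually_elim simp
qed

lemma influence_coeff:
  "real d * fact d * influence d f k = (\<Sum>T\<in>Pow (coords - {k}). (c (insert k T))\<^sup>2)"
  by (rule influence_walsh_coeff[OF kernel degree_pos finite_coords]) (use kernel_support in auto)

text \<open>Changing the sign of coordinate \<open>k\<close> changes \<open>F\<close> by \<open>B / sqrt (p\<^sub>k (1 - p\<^sub>k))\<close>, where \<open>B\<close> is the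
polynomial that multiplies \<open>Y\<^sub>k\<close>. This is an integer at every point of the cube, so its square is
at least \<open>1\<close> wherever it is not zero. Since \<open>B\<close> has degree \<open>d - 1\<close>, this happens with probability at
least \<open>\<epsilon>\<^sup>d\<^sup>-\<^sup>1\<close>, and the mean of \<open>B\<^sup>2\<close> is \<open>d d!\<close> times the influence.\<close>

lemma influence_ge:
  assumes "influence d f k > 0"
  shows "\<epsilon> ^ d * (1 - \<epsilon>) \<le> real d * fact d * influence d f k"
proof -
  let ?W = "coords - {k}" and ?b = "\<lambda>T. c (insert k T)" and ?s = "p k * (1 - p k)"
  have W: "finite ?W" "k \<notin> ?W" "insert k ?W = coords"
    using finite_coords assms by (auto simp: coords_def)
  have s: "?s > 0" using p01 by simp
  have pk: "\<epsilon> * (1 - \<epsilon>) \<le> ?s" using p_bounds[OF assms] by (auto intro: bernoulli_variance_ge)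
  have int: "?s * of_bool (walsh p ?b ?W U \<noteq> 0) \<le> (walsh p ?b ?W U)\<^sup>2" if U: "U \<subseteq> ?W" for U
  proof (cases "walsh p ?b ?W U = 0")
    case False
    have "walsh p c coords (insert k U) - walsh p c coords U =
        (coin p k True - coin p k False) * walsh p ?b ?W U"
    proof -
      have "k \<notin> U" using U by auto
      moreover have "walsh p c coords U' =
          walsh p c ?W U' + coin p k (k \<in> U') * walsh p ?b ?W U'" for U'
        using walsh_insert[OF W(1,2), of p c U'] unfolding W(3) .
      ultimately show ?thesis
        by (simp add: walsh_insert_coord[OF W(2)] algebra_simps)
    qed
    also have "\<dots> = walsh p ?b ?W U / sqrt ?s" by (simp add: coin_gap)
    finally have "walsh p ?b ?W U / sqrt ?s =
        (walsh p c coords (insert k U) + \<theta>) - (walsh p c coords U + \<theta>)" by simp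
    also have "\<dots> \<in> \<int>" using U W(3) by (intro Ints_diff walsh_integer) auto
    finally have "(walsh p ?b ?W U / sqrt ?s)\<^sup>2 \<ge> 1"
      using False s by (intro Ints_nonzero_square_ge_1) auto
    then show ?thesis using False s by (simp add: power_divide field_simps)
  qed simp
  obtain T0 where T0: "T0 \<subseteq> ?W" "?b T0 \<noteq> 0"
  proof -
    have "(\<Sum>T\<in>Pow ?W. (?b T)\<^sup>2) \<noteq> 0"
      using assms degree_pos by (simp flip: influence_coeff)
    then obtain T where "T \<in> Pow ?W" "(?b T)\<^sup>2 \<noteq> 0" by (meson sum.neutral)
    then show ?thesis using that by auto
  qed
  have card: "card T \<le> d - 1" if "T \<subseteq> ?W" "?b T \<noteq> 0" for T
  proof -
    have "k \<notin> T" "finite T" using that(1) finite_subset[OF that(1) W(1)] by auto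
    then show ?thesis using c_support(2)[OF that(2)] by simp
  qed
  have "\<epsilon> ^ (d - 1) \<le> cube_mean p ?W (\<lambda>U. of_bool (walsh p ?b ?W U \<noteq> 0))"
    using eps_pos eps_le p_bounds W(1) T0 card
    by (intro nonvanishing_weight[where ?T0.0 = T0]) (auto simp: coords_def)
  then have "?s * \<epsilon> ^ (d - 1) \<le> cube_mean p ?W (\<lambda>U. ?s * of_bool (walsh p ?b ?W U \<noteq> 0))"
    unfolding cube_mean_scale using s by (intro mult_left_mono) auto
  also have "\<dots> \<le> cube_mean p ?W (\<lambda>U. (walsh p ?b ?W U)\<^sup>2)"
    by (rule cube_mean_mono[OF _ int]) (auto simp: p01)
  also have "\<dots> = real d * fact d * influence d f k"
    unfolding influence_coeff using W(1) p01 by (intro cube_mean_walsh_square) auto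
  finally have "?s * \<epsilon> ^ (d - 1) \<le> real d * fact d * influence d f k" .
  moreover have "\<epsilon> ^ d * (1 - \<epsilon>) = (\<epsilon> * (1 - \<epsilon>)) * \<epsilon> ^ (d - 1)"
    using degree_pos by (cases d) (auto simp: algebra_simps)
  moreover have "(\<epsilon> * (1 - \<epsilon>)) * \<epsilon> ^ (d - 1) \<le> ?s * \<epsilon> ^ (d - 1)"
    using pk eps_pos by (intro mult_right_mono) auto
  ultimately show ?thesis by linarith
qed

lemma expectation_F: "integrable M F" "expectation F = 0"
proof -
  let ?G = "\<lambda>x. walsh p c coords (plus_set X coords x)"
  have G: "has_bochner_integral M ?G (cube_mean p coords (walsh p c coords))"
    by (rule has_expectation_plus_set[OF finite_coords])
  have "cube_mean p coords (walsh p c coords) = 0"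
    using degree_pos by (simp add: cube_mean_walsh finite_coords walsh_coeff_def)
  with G have "has_bochner_integral M F 0"
    using F_square_integrable(1) F_eq_walsh
    by (subst has_bochner_integral_cong_AE[where g = ?G])
       (auto simp: has_bochner_integral_iff)
  then show "integrable M F" "expectation F = 0" by (auto simp: has_bochner_integral_iff)
qed

lemma expectation_F_square: "expectation (\<lambda>x. (F x)\<^sup>2) = (\<Sum>T\<in>Pow coords. (c T)\<^sup>2)"
proof -
  let ?G = "\<lambda>x. walsh p c coords (plus_set X coords x)"
  have "expectation (\<lambda>x. (F x)\<^sup>2) = expectation (\<lambda>x. (?G x)\<^sup>2)"
  proof (rule integral_cong_AE)
    show "(\<lambda>x. (?G x)\<^sup>2) \<in> borel_measurable M"
      using integrable_plus_set[OF finite_coords, of "\<lambda>U. (walsh p c coords U)\<^sup>2"] by auto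
    show "AE x in M. (F x)\<^sup>2 = (?G x)\<^sup>2" using F_eq_walsh by eventually_elim simp
  qed (use F_square_integrable in auto)
  also have "\<dots> = cube_mean p coords (\<lambda>U. (walsh p c coords U)\<^sup>2)"
    by (rule expectation_plus_set[OF finite_coords, where g = "\<lambda>U. (walsh p c coords U)\<^sup>2"])
  also have "\<dots> = (\<Sum>T\<in>Pow coords. (c T)\<^sup>2)"
    using finite_coords p01 by (intro cube_mean_walsh_square) auto
  finally show ?thesis .
qed

lemma variance_shift: "variance (\<lambda>x. F x + \<theta>) = expectation (\<lambda>x. (F x)\<^sup>2)"
  using expectation_F by (simp add: prob_space)

text \<open>Each set in the support of the coefficients has exactly \<open>d\<close> elements, so it is counted \<open>d\<close> times
when the influences are added up.\<close>

lemma total_influence: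
  "(\<Sum>k\<in>coords. real d * fact d * influence d f k) = real d * expectation (\<lambda>x. (F x)\<^sup>2)"
proof -
  have "real d * fact d * influence d f k = (\<Sum>T\<in>Pow coords. of_bool (k \<in> T) * (c T)\<^sup>2)"
    if "k \<in> coords" for k
  proof -
    let ?W = "coords - {k}"
    have W: "finite ?W" "k \<notin> ?W" "insert k ?W = coords" using that finite_coords by auto
    have "(\<Sum>T\<in>Pow (insert k ?W). of_bool (k \<in> T) * (c T)\<^sup>2) = (\<Sum>T\<in>Pow ?W. (c (insert k T))\<^sup>2)"
      unfolding sum_Pow_insert[OF W(1,2)] by (intro sum.cong) auto
    then show ?thesis unfolding influence_coeff W(3) by simp
  qed
  then have "(\<Sum>k\<in>coords. real d * fact d * influence d f k) =
      (\<Sum>k\<in>coords. \<Sum>T\<in>Pow coords. of_bool (k \<in> T) * (c T)\<^sup>2)" by simp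
  also have "\<dots> = (\<Sum>T\<in>Pow coords. \<Sum>k\<in>coords. of_bool (k \<in> T) * (c T)\<^sup>2)"
    by (rule sum.swap)
  also have "\<dots> = (\<Sum>T\<in>Pow coords. real d * (c T)\<^sup>2)"
  proof (rule sum.cong[OF refl])
    fix T assume "T \<in> Pow coords"
    then have "(\<Sum>k\<in>coords. of_bool (k \<in> T)) = real (card T)"
      using finite_coords by (simp add: Int_absorb1 flip: sum.inter_restrict)
    then have "(\<Sum>k\<in>coords. of_bool (k \<in> T) * (c T)\<^sup>2) = real (card T) * (c T)\<^sup>2"
      by (simp flip: sum_distrib_right)
    then show "(\<Sum>k\<in>coords. of_bool (k \<in> T) * (c T)\<^sup>2) = real d * (c T)\<^sup>2"
      using c_support(2)[of T] by (cases "c T = 0") auto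
  qed
  finally show ?thesis by (simp add: expectation_F_square sum_distrib_left)
qed

lemma card_coords_le:
  "real (card coords) \<le> real d * expectation (\<lambda>x. (F x)\<^sup>2) / (\<epsilon> ^ d * (1 - \<epsilon>))"
proof -
  have "real (card coords) * (\<epsilon> ^ d * (1 - \<epsilon>)) = (\<Sum>k\<in>coords. \<epsilon> ^ d * (1 - \<epsilon>))" by simp
  also have "\<dots> \<le> (\<Sum>k\<in>coords. real d * fact d * influence d f k)"
    by (intro sum_mono influence_ge) (auto simp: coords_def)
  finally show ?thesis
    using eps_pos eps_le by (simp add: total_influence pos_le_divide_eq)
qed

text \<open>A function of finitely many signs takes at most as many values as there are sign patterns.\<close>

lemma few_values:
  "\<exists>Z. finite Z \<and> card Z \<le> 2 ^ card coords \<and> (AE x in M. F x + \<theta> \<in> Z)"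
proof (intro exI conjI)
  let ?Z = "(\<lambda>U. walsh p c coords U + \<theta>) ` Pow coords"
  show "finite ?Z" using finite_coords by simp
  show "card ?Z \<le> 2 ^ card coords"
    using card_image_le[of "Pow coords"] finite_coords by (simp add: card_Pow)
  show "AE x in M. F x + \<theta> \<in> ?Z"
    using F_eq_walsh
  proof eventually_elim
    case (elim x)
    show ?case unfolding elim by (rule imageI[OF plus_set_subset])
  qed
qed

end

section \<open>Poisson limits\<close>

text \<open>A Poisson law charges the neighbourhood of each of \<open>0, \<dots>, N\<close>. Convergence in law at the half
integers, which are not atoms, makes some \<open>G n\<close> charge all these disjoint neighbourhoods at
once, so that it has more than \<open>N\<close> values.\<close>

lemma poisson_limit_has_many_values:
  assumes "prob_space M" and l: "l > 0"
    and meas: "\<And>n. G n \<in> borel_measurable M"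
    and conv: "weak_conv_m (\<lambda>n. distr M borel (G n)) (poisson_law l)"
    and fin: "\<And>n. finite (Z n)" and vals: "\<And>n. AE x in M. G n x \<in> Z n"
  shows "\<exists>n. card (Z n) > N"
proof -
  interpret prob_space M by fact
  interpret P: prob_space "poisson_law l"
    unfolding poisson_law_def by (intro measure_pmf.prob_space_distr) simp
  interpret P: finite_borel_measure "poisson_law l"
    by unfold_locales (simp add: poisson_law_def)
  let ?I = "\<lambda>j::nat. {real j - 1/2 <.. real j + 1/2}"
  have cont: "isCont (cdf (poisson_law l)) (real j + 1/2)" "isCont (cdf (poisson_law l)) (real j - 1/2)" for j
  proof -
    have "measure (poisson_law l) {y} = 0" if "y \<notin> \<nat>" for y
    proof -
      have "real -` {y} = {}" using that by auto
      then show ?thesis by (simp add: poisson_law_def measure_distr)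
    qed
    moreover have "real j + 1/2 \<notin> \<nat>" "real j - 1/2 \<notin> \<nat>"
    proof -
      show "real j + 1/2 \<notin> \<nat>"
      proof
        assume "real j + 1/2 \<in> \<nat>"
        then obtain m where "real j + 1/2 = real m" by (auto elim: Nats_cases)
        then have "real (2 * j + 1) = real (2 * m)" by simp
        then have "2 * j + 1 = 2 * m" by (simp only: of_nat_eq_iff)
        then show False by presburger
      qed
      show "real j - 1/2 \<notin> \<nat>"
      proof
        assume "real j - 1/2 \<in> \<nat>"
        then obtain m where "real j - 1/2 = real m" by (auto elim: Nats_cases)
        then have "real (2 * j) = real (2 * m + 1)" by simp
        then have "2 * j = 2 * m + 1" by (simp only: of_nat_eq_iff)
        then show False by presburger
      qed
    qed
    ultimately show "isCont (cdf (poisson_law l)) (real j + 1/2)"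
      "isCont (cdf (poisson_law l)) (real j - 1/2)"
      by (auto simp: P.isCont_cdf)
  qed
  have pos: "measure (poisson_law l) (?I j) > 0" for j
  proof -
    have "0 < pmf (poisson_pmf l) j" using l by simp
    also have "\<dots> = measure (measure_pmf (poisson_pmf l)) {j}" by (simp add: measure_pmf_single)
    also have "\<dots> \<le> measure (measure_pmf (poisson_pmf l)) (real -` ?I j)"
      by (intro measure_pmf.finite_measure_mono) auto
    finally show ?thesis by (simp add: poisson_law_def measure_distr)
  qed
  have ev: "\<forall>\<^sub>F n in sequentially. prob (G n -` ?I j \<inter> space M) > 0" for j
  proof -
    let ?D = "\<lambda>n. distr M borel (G n)"
    have diff: "cdf (?D n) (real j + 1/2) - cdf (?D n) (real j - 1/2) = prob (G n -` ?I j \<inter> space M)" for n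
    proof -
      interpret D: prob_space "?D n" by (rule prob_space_distr[OF meas])
      interpret D: finite_borel_measure "?D n" by unfold_locales simp
      show ?thesis by (subst D.cdf_diff_eq) (auto simp: measure_distr meas)
    qed
    have "(\<lambda>n. cdf (?D n) (real j + 1/2) - cdf (?D n) (real j - 1/2)) \<longlonglongrightarrow>
        cdf (poisson_law l) (real j + 1/2) - cdf (poisson_law l) (real j - 1/2)"
      using conv cont[of j] by (intro tendsto_diff) (auto simp: weak_conv_m_def weak_conv_def)
    also have "cdf (poisson_law l) (real j + 1/2) - cdf (poisson_law l) (real j - 1/2) =
        measure (poisson_law l) (?I j)"
      by (rule P.cdf_diff_eq) simp
    finally show ?thesis
      unfolding diff using pos[of j] by (rule order_tendstoD(1))
  qed
  have "\<forall>\<^sub>F n in sequentially. \<forall>j\<in>{..N}. prob (G n -` ?I j \<inter> space M) > 0"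
    using ev by (intro eventually_ball_finite) auto
  then obtain n where n: "\<And>j. j \<le> N \<Longrightarrow> prob (G n -` ?I j \<inter> space M) > 0"
    by (auto simp: eventually_sequentially)
  have "\<exists>z\<in>Z n. z \<in> ?I j" if "j \<le> N" for j
  proof (rule ccontr)
    assume "\<not> ?thesis"
    then have none: "\<And>z. z \<in> Z n \<Longrightarrow> z \<notin> ?I j" by blast
    have "AE x in M. x \<notin> G n -` ?I j \<inter> space M"
      using vals[of n] by eventually_elim (use none in auto)
    then have "prob (G n -` ?I j \<inter> space M) = 0"
      using measurable_sets[OF meas[of n], of "?I j"] by (subst prob_eq_0) auto
    then show False using n[OF that] by simp
  qed
  then obtain z where z: "\<And>j. j \<le> N \<Longrightarrow> z j \<in> Z n \<and> z j \<in> ?I j" by metis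
  have "inj_on z {..N}"
  proof (rule inj_onI)
    fix i j assume "i \<in> {..N}" "j \<in> {..N}" "z i = z j"
    then have "real i - 1/2 < real j + 1/2" "real j - 1/2 < real i + 1/2"
      using z[of i] z[of j] by auto
    then show "i = j" by linarith
  qed
  then have "card {..N} \<le> card (Z n)"
    using z fin by (intro card_inj_on_le[of z]) auto
  then show ?thesis by (intro exI[of _ n]) simp
qed

text \<open>A common bound on the variances bounds the number of coordinates, hence the number of values, of
all members of the sequence; a Poisson limit needs unboundedly many values.\<close>

lemma no_poisson_limit:
  fixes M :: "'a measure"
  assumes "rademacher_sequence M X p" "d \<ge> 1"
  shows "\<not> (\<exists>(f :: nat \<Rightarrow> nat list \<Rightarrow> real) (F :: nat \<Rightarrow> 'a \<Rightarrow> real) (\<theta> :: nat \<Rightarrow> real) \<epsilon> C l.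
          (\<forall>n. in_rademacher_chaos M X p d (f n) (F n)) \<and>
          (\<forall>n. AE x in M. F n x + \<theta> n \<in> \<int>) \<and>
          \<epsilon> > 0 \<and>
          (\<forall>n k. influence d (f n) k > 0 \<longrightarrow> \<epsilon> \<le> p k \<and> p k \<le> 1 - \<epsilon>) \<and>
          (\<forall>n. prob_space.variance M (\<lambda>x. F n x + \<theta> n) \<le> C) \<and>
          l > 0 \<and>
          weak_conv_m (\<lambda>n. distr M borel (\<lambda>x. F n x + \<theta> n)) (poisson_law l))"
proof (rule notI, elim exE conjE)
  fix f :: "nat \<Rightarrow> nat list \<Rightarrow> real" and F :: "nat \<Rightarrow> 'a \<Rightarrow> real" and \<theta> \<epsilon> C l
  assume chaos: "\<forall>n. in_rademacher_chaos M X p d (f n) (F n)"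
    and int: "\<forall>n. AE x in M. F n x + \<theta> n \<in> \<int>" and "\<epsilon> > 0"
    and pb: "\<forall>n k. influence d (f n) k > 0 \<longrightarrow> \<epsilon> \<le> p k \<and> p k \<le> 1 - \<epsilon>"
    and var: "\<forall>n. prob_space.variance M (\<lambda>x. F n x + \<theta> n) \<le> C" and "l > 0"
    and conv: "weak_conv_m (\<lambda>n. distr M borel (\<lambda>x. F n x + \<theta> n)) (poisson_law l)"
  interpret rademacher_sequence M X p by fact
  \<comment> \<open>If \<open>\<epsilon> > 1/2\<close>, there are no dependent coordinates at all, and any smaller constant serves as well.\<close>
  define \<delta> where "\<delta> = min \<epsilon> (1/2)"
  have loc: "integer_chaos M X p d (f n) (F n) (\<theta> n) \<delta>" for n
  proof unfold_locales
    show "\<delta> \<le> p k \<and> p k \<le> 1 - \<delta>" if "influence d (f n) k > 0" for k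
      using pb that by (fastforce simp: \<delta>_def)
  qed (use chaos int \<open>d \<ge> 1\<close> \<open>\<epsilon> > 0\<close> in \<open>auto simp: \<delta>_def\<close>)
  have \<delta>: "\<delta> ^ d * (1 - \<delta>) > 0" using \<open>\<epsilon> > 0\<close> by (auto simp: \<delta>_def min_def)
  define K where "K = nat \<lfloor>real d * C / (\<delta> ^ d * (1 - \<delta>))\<rfloor>"
  have "\<exists>Z. finite Z \<and> card Z \<le> 2 ^ K \<and> (AE x in M. F n x + \<theta> n \<in> Z)" for n
  proof -
    interpret integer_chaos M X p d "f n" "F n" "\<theta> n" \<delta> by (rule loc)
    have "real (card coords) \<le> real d * expectation (\<lambda>x. (F n x)\<^sup>2) / (\<delta> ^ d * (1 - \<delta>))"
      by (rule card_coords_le)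
    also have "\<dots> \<le> real d * C / (\<delta> ^ d * (1 - \<delta>))"
      using spec[OF var, of n] \<delta> unfolding variance_shift by (intro divide_right_mono mult_left_mono) auto
    finally have "card coords \<le> K" unfolding K_def by (simp add: le_nat_floor)
    then have "(2::nat) ^ card coords \<le> 2 ^ K" by simp
    then show ?thesis using few_values by (meson order_trans)
  qed
  then obtain Z where Z: "\<And>n. finite (Z n)" "\<And>n. card (Z n) \<le> 2 ^ K"
      "\<And>n. AE x in M. F n x + \<theta> n \<in> Z n"
    by metis
  have "(\<lambda>x. F n x + \<theta> n) \<in> borel_measurable M" for n
  proof -
    interpret integer_chaos M X p d "f n" "F n" "\<theta> n" \<delta> by (rule loc)
    show ?thesis using F_square_integrable(1) by simp
  qed
  from poisson_limit_has_many_values[OF prob_space_axioms \<open>l > 0\<close> this conv Z(1,3), of "2 ^ K"]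
  show False using Z(2) by (meson not_less)
qed

section \<open>Minimal influence and absence of Poisson limits\<close>

theorem theorem1p7:
  fixes M :: "'a measure" and X :: "nat \<Rightarrow> 'a \<Rightarrow> real" and p :: "nat \<Rightarrow> real" and d :: nat
  assumes "rademacher_sequence M X p" and "d \<ge> 1"
  shows
    "(\<forall>f F \<theta> \<epsilon>. in_rademacher_chaos M X p d f F \<and> (AE x in M. F x + \<theta> \<in> \<nat>) \<and>
        0 < \<epsilon> \<and> \<epsilon> \<le> 1/2 \<and> (\<forall>k. influence d f k > 0 \<longrightarrow> \<epsilon> \<le> p k \<and> p k \<le> 1 - \<epsilon>) \<longrightarrow>
        (\<forall>k. influence d f k > 0 \<longrightarrow> real d * fact d * influence d f k \<ge> \<epsilon> ^ d * (1 - \<epsilon>)) \<and>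
        finite {k. influence d f k > 0} \<and>
        real (card {k. influence d f k > 0})
          \<le> real d * prob_space.expectation M (\<lambda>x. (F x)\<^sup>2) / (\<epsilon> ^ d * (1 - \<epsilon>)))
     \<and>
     (\<forall>f F \<theta>. in_rademacher_chaos M X p d f F \<and> (AE x in M. F x + \<theta> \<in> \<nat>) \<and>
        (\<forall>k. p k = 1/2) \<longrightarrow>
        (\<forall>k. influence d f k > 0 \<longrightarrow>
           influence d f k \<ge> 1 / 2 ^ (d + 1) / (real d * fact d)))
     \<and>
     \<not> (\<exists>(f :: nat \<Rightarrow> nat list \<Rightarrow> real) (F :: nat \<Rightarrow> 'a \<Rightarrow> real) (\<theta> :: nat \<Rightarrow> real) \<epsilon> C l.
          (\<forall>n. in_rademacher_chaos M X p d (f n) (F n)) \<and>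
          (\<forall>n. AE x in M. F n x + \<theta> n \<in> \<int>) \<and>
          \<epsilon> > 0 \<and>
          (\<forall>n k. influence d (f n) k > 0 \<longrightarrow> \<epsilon> \<le> p k \<and> p k \<le> 1 - \<epsilon>) \<and>
          (\<forall>n. prob_space.variance M (\<lambda>x. F n x + \<theta> n) \<le> C) \<and>
          l > 0 \<and>
          weak_conv_m (\<lambda>n. distr M borel (\<lambda>x. F n x + \<theta> n)) (poisson_law l))"
proof -
  interpret rademacher_sequence M X p by fact
  have integer: "integer_chaos M X p d f F \<theta> \<epsilon>"
    if "in_rademacher_chaos M X p d f F" "AE x in M. F x + \<theta> \<in> \<nat>" "0 < \<epsilon>" "\<epsilon> \<le> 1/2"
      "\<forall>k. influence d f k > 0 \<longrightarrow> \<epsilon> \<le> p k \<and> p k \<le> 1 - \<epsilon>" for f F \<theta> \<epsilon>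
  proof unfold_locales
    show "AE x in M. F x + \<theta> \<in> \<int>"
      using that(2) by eventually_elim (use Nats_subset_Ints in auto)
  qed (use that \<open>d \<ge> 1\<close> in auto)
  have bounds: "(\<forall>k. influence d f k > 0 \<longrightarrow> real d * fact d * influence d f k \<ge> \<epsilon> ^ d * (1 - \<epsilon>)) \<and>
        finite {k. influence d f k > 0} \<and>
        real (card {k. influence d f k > 0}) \<le> real d * expectation (\<lambda>x. (F x)\<^sup>2) / (\<epsilon> ^ d * (1 - \<epsilon>))"
    if "integer_chaos M X p d f F \<theta> \<epsilon>" for f F \<theta> \<epsilon>
  proof -
    interpret integer_chaos M X p d f F \<theta> \<epsilon> by (rule that)
    show ?thesis
      using influence_ge finite_coords card_coords_le by (auto simp: coords_def)
  qed
  have symmetric: "influence d f k \<ge> 1 / 2 ^ (d + 1) / (real d * fact d)"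
    if "in_rademacher_chaos M X p d f F" "AE x in M. F x + \<theta> \<in> \<nat>" "\<forall>k. p k = 1/2"
      "influence d f k > 0" for f F \<theta> k
  proof -
    have "integer_chaos M X p d f F \<theta> (1/2)" using that by (intro integer) auto
    from bounds[OF this] that(4) have "(1/2) ^ d * (1 - 1/2) \<le> real d * fact d * influence d f k" by blast
    then have "1 / 2 ^ (d + 1) \<le> influence d f k * (real d * fact d)"
      by (simp add: power_one_over mult_ac)
    then show ?thesis using \<open>d \<ge> 1\<close> by (subst pos_divide_le_eq) auto
  qed
  show ?thesis
  proof (intro conjI)
    show "\<not> (\<exists>(f :: nat \<Rightarrow> nat list \<Rightarrow> real) (F :: nat \<Rightarrow> 'a \<Rightarrow> real) (\<theta> :: nat \<Rightarrow> real) \<epsilon> C l.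
          (\<forall>n. in_rademacher_chaos M X p d (f n) (F n)) \<and>
          (\<forall>n. AE x in M. F n x + \<theta> n \<in> \<int>) \<and>
          \<epsilon> > 0 \<and>
          (\<forall>n k. influence d (f n) k > 0 \<longrightarrow> \<epsilon> \<le> p k \<and> p k \<le> 1 - \<epsilon>) \<and>
          (\<forall>n. prob_space.variance M (\<lambda>x. F n x + \<theta> n) \<le> C) \<and>
          l > 0 \<and>
          weak_conv_m (\<lambda>n. distr M borel (\<lambda>x. F n x + \<theta> n)) (poisson_law l))"
      by (rule no_poisson_limit[OF assms])
  next
    show "\<forall>f F \<theta>. in_rademacher_chaos M X p d f F \<and> (AE x in M. F x + \<theta> \<in> \<nat>) \<and>
        (\<forall>k. p k = 1/2) \<longrightarrow>
        (\<forall>k. influence d f k > 0 \<longrightarrow> influence d f k \<ge> 1 / 2 ^ (d + 1) / (real d * fact d))"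
      by (intro allI impI, elim conjE) (rule symmetric)
  qed (intro allI impI, elim conjE, rule bounds[OF integer]; assumption)
qed

end
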